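(* Consider the delayed periodic system $$\frac{du_i}{dt}=-d_i(t)u_i(t)+\sum_{j=1}^n a_{ij}(t)g_j(u_j(t))+\sum_{j=1}^n b_{ij}(t)f_j(u_j(t-\tau_{ij}))+I_i(t),\quad i=1,\dots,n, \qquad (S)$$ with the standing assumptions given in the context. Suppose $g=(g_1,\dots,g_n)^T\in H\{G_1,\dots,G_n\}$ and $f=(f_1,\dots,f_n)^T\in H\{F_1,\dots,F_n\}$. (1) If there are positive constants $\epsilon,\theta_1,\dots,\theta_n$ such that for every $i=1,\dots,n$ $$(-d_i+\epsilon)\theta_i+G_i\Big[\theta_i|a_{ii}^*|+\sum_{j\ne i}\theta_j|a_{ji}^*|\Big]+F_i\sum_{j=1}^n\theta_j|b_{ji}^*|e^{\epsilon\tau_{ji}}\le 0,$$ then $(S)$ has a unique $\omega$-periodic solution $v(t)=[v_1(t),\dots,v_n(t)]^T$, and for any solution $u(t)=[u_1(t),\dots,u_n(t)]^T$ of $(S)$, $|u_i(t+j\omega)-v_i(t)|=O(e^{-j\epsilon\omega})$ as $j\to\infty$, $i=1,\dots,n$. (2) If there are positive constants $\theta_1,\dots,\theta_n$ such that for every $i=1,\dots,n$ $$-d_i\theta_i+G_i\Big[\theta_i|a_{ii}^*|+\sum_{j\ne i}\theta_j|a_{ji}^*|\Big]+F_i\sum_{j=1}^n\theta_j|b_{ji}^*|<0,$$ then $(S)$ has a unique $\omega$-periodic solution $v(t)=[v_1(t),\dots,v_n(t)]^T$, and there is $\epsilon>0$ such that for any solution $u(t)=[u_1(t),\dots,u_n(t)]^T$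 of $(S)$, $|u_i(t+j\omega)-v_i(t)|=O(e^{-j\epsilon\omega})$ as $j\to\infty$, $i=1,\dots,n$.
   Context: Standing assumptions: $n\ge1$; $\omega>0$; $\tau_{ij}\ge 0$ are constants and $\tau=\max_{i,j}\tau_{ij}$; $d_i(t),a_{ij}(t),b_{ij}(t),I_i(t):\mathbf R^+\to\mathbf R$ are continuous and periodic with period $\omega$; $d_i(t)\ge d_i>0$ for all $t$, where $d_i$ are constants. Notation: $|a_{ij}^*|=\sup_{0<t\le\omega}|a_{ij}(t)|$, $|b_{ij}^*|=\sup_{0<t\le\omega}|b_{ij}(t)|$. A solution of $(S)$ is a continuous function $u$ on $[-\tau,\infty)$ satisfying $(S)$ for $t\ge 0$, with initial condition $u_i(s)=\phi_i(s)$ for $s\in[-\tau,0]$, $\phi_i\in C([-\tau,0])$ arbitrary. A periodic solution is a solution $v$ with $v(t+\omega)=v(t)$ for all $t\ge-\tau$. For constants $G_i>0$, a vector of functions $g=(g_1,\dots,g_n)^T$, $g_i:\mathbf R\to\mathbf R$, belongs to $H\{G_1,\dots,G_n\}$ if $\frac{|g_i(x+u)-g_i(x)|}{|u|}\le G_i$ for all $x\in\mathbf R$, $u\ne 0$, $i=1,\dots,n$. The functions are not assumed bounded. *)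

theory Defs
  imports "HOL-Analysis.Analysis" "HOL-Library.Landau_Symbols"
begin

definition max_delay :: "('n::finite \<Rightarrow> 'n \<Rightarrow> real) \<Rightarrow> real" where
  "max_delay \<tau> = Max (range (\<lambda>(i, j). \<tau> i j))"

definition continuous_periodic :: "real \<Rightarrow> (real \<Rightarrow> real) \<Rightarrow> bool" where
  "continuous_periodic \<omega> h \<longleftrightarrow>
     continuous_on {0..} h \<and> (\<forall>t\<ge>0. h (t + \<omega>) = h t)"

definition period_sup :: "real \<Rightarrow> (real \<Rightarrow> real) \<Rightarrow> real" where
  "period_sup \<omega> h = (SUP t\<in>{0<..\<omega>}. \<bar>h t\<bar>)"

definition class_H :: "('n \<Rightarrow> real) \<Rightarrow> ('n \<Rightarrow> real \<Rightarrow> real) set" where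
  "class_H G = {g. \<forall>i x u. u \<noteq> 0 \<longrightarrow> \<bar>g i (x + u) - g i x\<bar> / \<bar>u\<bar> \<le> G i}"

definition delay_rhs ::
  "('n::finite \<Rightarrow> real \<Rightarrow> real) \<Rightarrow> ('n \<Rightarrow> 'n \<Rightarrow> real \<Rightarrow> real) \<Rightarrow> ('n \<Rightarrow> 'n \<Rightarrow> real \<Rightarrow> real)
    \<Rightarrow> ('n \<Rightarrow> real \<Rightarrow> real) \<Rightarrow> ('n \<Rightarrow> 'n \<Rightarrow> real) \<Rightarrow> ('n \<Rightarrow> real \<Rightarrow> real) \<Rightarrow> ('n \<Rightarrow> real \<Rightarrow> real)
    \<Rightarrow> (real \<Rightarrow> real ^ 'n) \<Rightarrow> 'n \<Rightarrow> real \<Rightarrow> real" where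
  "delay_rhs d a b I \<tau> g f u i t =
     - d i t * u t $ i
     + (\<Sum>j\<in>UNIV. a i j t * g j (u t $ j))
     + (\<Sum>j\<in>UNIV. b i j t * f j (u (t - \<tau> i j) $ j))
     + I i t"

text \<open>Functions on $[-\tau,\infty)$ are represented by total functions whose values to the left of
  $-\tau$ are irrelevant. The derivative relative to $[0,\infty)$ is the right derivative at $0$ and
  the ordinary derivative at every $t > 0$. The initial function is the restriction of \<open>u\<close> to
  $[-\tau,0]$, so that continuity of \<open>u\<close> is the only constraint on it.\<close>

definition delay_solution ::
  "('n::finite \<Rightarrow> real \<Rightarrow> real) \<Rightarrow> ('n \<Rightarrow> 'n \<Rightarrow> real \<Rightarrow> real) \<Rightarrow> ('n \<Rightarrow> 'n \<Rightarrow> real \<Rightarrow> real)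
    \<Rightarrow> ('n \<Rightarrow> real \<Rightarrow> real) \<Rightarrow> ('n \<Rightarrow> 'n \<Rightarrow> real) \<Rightarrow> ('n \<Rightarrow> real \<Rightarrow> real) \<Rightarrow> ('n \<Rightarrow> real \<Rightarrow> real)
    \<Rightarrow> (real \<Rightarrow> real ^ 'n) \<Rightarrow> bool" where
  "delay_solution d a b I \<tau> g f u \<longleftrightarrow>
     continuous_on {- max_delay \<tau>..} u \<and>
     (\<forall>i. \<forall>t\<ge>0. ((\<lambda>s. u s $ i) has_real_derivative delay_rhs d a b I \<tau> g f u i t)
                    (at t within {0..}))"

definition periodic_delay_solution ::
  "real \<Rightarrow> ('n::finite \<Rightarrow> real \<Rightarrow> real) \<Rightarrow> ('n \<Rightarrow> 'n \<Rightarrow> real \<Rightarrow> real) \<Rightarrow> ('n \<Rightarrow> 'n \<Rightarrow> real \<Rightarrow> real)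
    \<Rightarrow> ('n \<Rightarrow> real \<Rightarrow> real) \<Rightarrow> ('n \<Rightarrow> 'n \<Rightarrow> real) \<Rightarrow> ('n \<Rightarrow> real \<Rightarrow> real) \<Rightarrow> ('n \<Rightarrow> real \<Rightarrow> real)
    \<Rightarrow> (real \<Rightarrow> real ^ 'n) \<Rightarrow> bool" where
  "periodic_delay_solution \<omega> d a b I \<tau> g f v \<longleftrightarrow>
     delay_solution d a b I \<tau> g f v \<and> (\<forall>t\<ge>- max_delay \<tau>. v (t + \<omega>) = v t)"

text \<open>Uniqueness is uniqueness as a function on $[-\tau,\infty)$.\<close>

definition unique_periodic_delay_solution ::
  "real \<Rightarrow> ('n::finite \<Rightarrow> real \<Rightarrow> real) \<Rightarrow> ('n \<Rightarrow> 'n \<Rightarrow> real \<Rightarrow> real) \<Rightarrow> ('n \<Rightarrow> 'n \<Rightarrow> real \<Rightarrow> real)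
    \<Rightarrow> ('n \<Rightarrow> real \<Rightarrow> real) \<Rightarrow> ('n \<Rightarrow> 'n \<Rightarrow> real) \<Rightarrow> ('n \<Rightarrow> real \<Rightarrow> real) \<Rightarrow> ('n \<Rightarrow> real \<Rightarrow> real)
    \<Rightarrow> (real \<Rightarrow> real ^ 'n) \<Rightarrow> bool" where
  "unique_periodic_delay_solution \<omega> d a b I \<tau> g f v \<longleftrightarrow>
     periodic_delay_solution \<omega> d a b I \<tau> g f v \<and>
     (\<forall>w. periodic_delay_solution \<omega> d a b I \<tau> g f w \<longrightarrow> (\<forall>t\<ge>- max_delay \<tau>. w t = v t))"

end

theory Submission
  imports Defs
begin

text \<open>The weights \<open>\<theta>\<close> make the coupling of the system subordinate to its damping in a weighted
  \<open>L\<^sup>1\<close>-sense: the hypothesis says that each column of the coupling matrix, weighted by \<open>\<theta>\<close>,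
  is dominated by the corresponding \<open>(d0 j - \<epsilon>) * \<theta> j\<close>. Every estimate below is therefore an
  integral estimate summed over the components with these weights.

  The basic tool is \<open>exp_weighted_abs_le_integral\<close>, an integral inequality for \<open>exp (\<epsilon> * t) * \<bar>w t\<bar>\<close>
  when \<open>w\<close> solves the scalar equation \<open>w' = - \<delta> w + h\<close>. Applied to the components of the difference of
  two solutions, multiplied by \<open>\<theta>\<close> and summed, it bounds \<open>\<Sum>i. \<theta> i * exp (\<epsilon> * t) * \<bar>u\<^sub>i t - v\<^sub>i t\<bar>\<close> by
  a constant (\<open>solutions_approach_exponentially\<close>): a delayed integral over \<open>[0,T]\<close> exceeds the
  undelayed one by at most an integral over the initial interval, and what remains has a nonpositive
  coefficient by hypothesis. This is the usual Lyapunov functional argument in integrated form, so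
  that absolute values never have to be differentiated. Both the rate of convergence and the
  uniqueness of the periodic solution follow.

  For existence, no initial value problem is solved. Given a periodic function \<open>\<phi>\<close>, insert it into
  the nonlinear terms only; the resulting decoupled linear equations have a periodic solution
  \<open>\<psi>\<close> (\<open>linear_periodic_solution_exists\<close>), and a fixed point of \<open>\<phi> \<mapsto> \<psi>\<close> is a periodic solution of
  the system. The same scalar inequality over one period, where the boundary terms cancel, shows
  that this map contracts the distance
  \<open>\<Sum>i. \<theta> i * d0 i * \<integral>\<bar>\<phi>\<^sub>i - \<psi>\<^sub>i\<bar>\<close> (\<open>periodic_response_L1_contraction\<close>). The map also
  smooths: the supremum distance of two images is bounded by the \<open>L\<^sup>1\<close>-distance of the arguments
  (\<open>periodic_response_sup_le\<close>). Hence the Picard iterates, which converge geometrically in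
  \<open>L\<^sup>1\<close>, converge uniformly, and their limit is a continuous fixed point.

  The strict inequality without a rate persists for small \<open>\<epsilon>\<close> by continuity, because there are only finitely
  many components; this reduces the second claim to the first.\<close>

section \<open>Functions that are periodic on a half-line\<close>

lemma periodic_plus_nat:
  fixes h :: "real \<Rightarrow> 'a"
  assumes "0 \<le> \<omega>" "t0 \<le> t" "\<And>t. t0 \<le> t \<Longrightarrow> h (t + \<omega>) = h t"
  shows "h (t + real n * \<omega>) = h t"
proof (induction n)
  case (Suc n)
  have "t0 \<le> t + real n * \<omega>" using assms(1,2) by (simp add: add_increasing2)
  then show ?case using assms(3)[of "t + real n * \<omega>"] Suc by (simp add: algebra_simps)
qed simp

text \<open>The extension to the whole line of a function that is periodic on \<open>[0,\<infinity>)\<close>: the argument is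
  reduced to \<open>[0,\<omega>)\<close>. The delayed arguments \<open>t - \<tau> i j\<close> may be negative, so periodic solutions of
  the linear equations, which are constructed on \<open>[0,\<infinity>)\<close>, have to be continued to the left.\<close>
definition periodic_ext :: "real \<Rightarrow> (real \<Rightarrow> 'a) \<Rightarrow> real \<Rightarrow> 'a" where
  "periodic_ext \<omega> h t = h (t - \<omega> * of_int \<lfloor>t / \<omega>\<rfloor>)"

lemma periodic_ext_plus:
  assumes "\<omega> > 0"
  shows "periodic_ext \<omega> h (t + \<omega>) = periodic_ext \<omega> h t"
proof -
  have "(t + \<omega>) / \<omega> = t / \<omega> + 1" using assms by (simp add: field_simps)
  then show ?thesis by (simp add: periodic_ext_def algebra_simps)
qed

lemma periodic_ext_eq:
  assumes "\<omega> > 0" "\<And>t. 0 \<le> t \<Longrightarrow> h (t + \<omega>) = h t" "0 \<le> t"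
  shows "periodic_ext \<omega> h t = h t"
proof -
  let ?r = "t - \<omega> * of_int \<lfloor>t / \<omega>\<rfloor>"
  have r: "0 \<le> ?r" using floor_divide_lower[OF assms(1)] by (simp add: mult.commute)
  have "h (?r + real (nat \<lfloor>t / \<omega>\<rfloor>) * \<omega>) = h ?r"
    using periodic_plus_nat[of \<omega> 0 ?r h "nat \<lfloor>t / \<omega>\<rfloor>"] assms r by simp
  moreover have "real (nat \<lfloor>t / \<omega>\<rfloor>) = of_int \<lfloor>t / \<omega>\<rfloor>"
    using assms(1,3) by simp
  ultimately show ?thesis by (simp add: periodic_ext_def algebra_simps)
qed

lemma periodic_ext_eq_self:
  fixes w :: "real \<Rightarrow> 'a"
  assumes "\<omega> > 0" "\<And>t. w (t + \<omega>) = w t"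
  shows "periodic_ext \<omega> w t = w t"
proof -
  obtain n :: nat where n: "- t / \<omega> < real n"
    using reals_Archimedean2 by blast
  then have "0 \<le> t + real n * \<omega>" using assms(1) by (simp add: field_simps)
  then have "periodic_ext \<omega> w (t + real n * \<omega>) = w (t + real n * \<omega>)"
    using assms by (intro periodic_ext_eq) auto
  moreover have "periodic_ext \<omega> w (t + real n * \<omega>) = periodic_ext \<omega> w t"
    using assms(1) by (intro periodic_plus_nat[where t0 = t]) (auto intro: periodic_ext_plus)
  moreover have "w (t + real n * \<omega>) = w t"
    using periodic_plus_nat[of \<omega> t t w n] assms by simp
  ultimately show ?thesis by simp
qed

text \<open>Near a given point the extension is a translate of \<open>h\<close> by a multiple of \<open>\<omega>\<close> large enough to move
  a neighbourhood into \<open>(0,\<infinity>)\<close>; so the jumps of the floor function do no harm.\<close>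
lemma continuous_on_periodic_ext:
  fixes h :: "real \<Rightarrow> 'a::topological_space"
  assumes "\<omega> > 0" "\<And>t. 0 \<le> t \<Longrightarrow> h (t + \<omega>) = h t" "continuous_on {0..} h"
  shows "continuous_on UNIV (periodic_ext \<omega> h)"
proof -
  have "isCont (periodic_ext \<omega> h) t" for t
  proof -
    obtain n :: nat where n: "- t / \<omega> < real n"
      using reals_Archimedean2 by blast
    let ?S = "{- real n * \<omega> <..}"
    have t: "t \<in> ?S" using n assms(1) by (simp add: field_simps)
    have ext: "periodic_ext \<omega> h s = h (s + real n * \<omega>)" if "s \<in> ?S" for s
    proof -
      have "periodic_ext \<omega> h s = periodic_ext \<omega> h (s + real n * \<omega>)"
        using assms(1) by (intro periodic_plus_nat[symmetric, where t0 = s])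
          (auto intro: periodic_ext_plus)
      also have "\<dots> = h (s + real n * \<omega>)"
        using assms(1,2) that by (intro periodic_ext_eq) auto
      finally show ?thesis .
    qed
    have "continuous_on ?S (\<lambda>s. h (s + real n * \<omega>))"
      by (intro continuous_on_compose2[OF assms(3)] continuous_intros) auto
    then have "continuous_on ?S (periodic_ext \<omega> h)"
      using ext by (metis (no_types, lifting) continuous_on_cong)
    then show ?thesis
      using t continuous_on_eq_continuous_at[OF open_greaterThan] by blast
  qed
  then show ?thesis by (simp add: continuous_at_imp_continuous_on)
qed

lemma diff_floor_multiple_bounds:
  fixes \<omega> t :: real
  assumes "\<omega> > 0"
  shows "0 \<le> t - \<omega> * of_int \<lfloor>t / \<omega>\<rfloor>" "t - \<omega> * of_int \<lfloor>t / \<omega>\<rfloor> < \<omega>"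
  using floor_divide_lower[OF assms, of t] floor_divide_upper[OF assms, of t]
  by (simp_all add: algebra_simps)

lemma abs_le_period_sup:
  assumes "\<omega> > 0" "continuous_periodic \<omega> h" "0 \<le> t"
  shows "\<bar>h t\<bar> \<le> period_sup \<omega> h"
proof -
  have cont: "continuous_on {0..} h" and per: "\<And>t. 0 \<le> t \<Longrightarrow> h (t + \<omega>) = h t"
    using assms(2) by (auto simp: continuous_periodic_def)
  define r where "r = t - \<omega> * of_int \<lfloor>t / \<omega>\<rfloor>"
  have r: "0 \<le> r" "r < \<omega>"
    using diff_floor_multiple_bounds[OF assms(1), of t] by (simp_all add: r_def)
  have "h t = h r"
    using periodic_ext_eq[where h = h, OF assms(1) per assms(3)] by (simp add: periodic_ext_def r_def)
  moreover have "h \<omega> = h 0" using per[of 0] by simp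
  (* The supremum is over the half-open interval without 0; there the point \<omega> represents 0. *)
  ultimately obtain s where s: "s \<in> {0<..\<omega>}" "h t = h s"
    using r assms(1) by (cases "r = 0") (auto intro: that[of \<omega>] that[of r])
  have "bounded ((\<lambda>t. \<bar>h t\<bar>) ` {0..\<omega>})"
    by (intro compact_imp_bounded compact_continuous_image continuous_intros
        continuous_on_subset[OF cont]) auto
  then have "bdd_above ((\<lambda>t. \<bar>h t\<bar>) ` {0<..\<omega>})"
    by (intro bounded_imp_bdd_above) (auto elim: bounded_subset)
  then show ?thesis
    using s unfolding period_sup_def by (auto intro: cSUP_upper)
qed

text \<open>The two windows \<open>[-s,\<omega>-s]\<close> and \<open>[0,\<omega>]\<close> are both complemented in \<open>[-s,\<omega>]\<close> by intervals of
  length \<open>s\<close> that differ by one period.\<close>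
lemma periodic_integral_shift:
  fixes p :: "real \<Rightarrow> real"
  assumes "0 \<le> \<omega>" "0 \<le> s" "continuous_on UNIV p" "\<And>t. p (t + \<omega>) = p t"
  shows "integral {0..\<omega>} (\<lambda>t. p (t - s)) = integral {0..\<omega>} p"
proof -
  have int: "p integrable_on {x..y}" for x y
    by (intro integrable_continuous_real continuous_on_subset[OF assms(3)]) auto
  have shift: "integral {x..y} (\<lambda>t. p (t + z)) = integral {x + z..y + z} p" for x y z
    using integral_shift[of x z y p] continuous_on_subset[OF assms(3)] by (auto simp: o_def)
  have "integral {-s..0} p + integral {0..\<omega>} p = integral {-s..\<omega>} p"
    using assms(1,2) by (intro Henstock_Kurzweil_Integration.integral_combine int) auto
  also have "\<dots> = integral {-s..\<omega> - s} p + integral {\<omega> - s..\<omega>} p"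
    using assms(1,2) by (intro Henstock_Kurzweil_Integration.integral_combine[symmetric] int) auto
  also have "integral {\<omega> - s..\<omega>} p = integral {-s..0} p"
    using shift[of "-s" 0 \<omega>] assms(4) by (simp add: algebra_simps)
  finally show ?thesis
    using shift[of 0 \<omega> "-s"] by simp
qed

section \<open>The scalar linear equation\<close>

text \<open>Formally, \<open>\<bar>w\<bar>' \<le> - c * \<bar>w\<bar> + \<bar>h\<bar>\<close>, and this is integrated against \<open>exp (\<epsilon> * t)\<close>. Since \<open>\<bar>w\<bar>\<close> need not be
  differentiable at zeros of \<open>w\<close>, the proof works with \<open>sqrt (w\<^sup>2 + \<eta>\<^sup>2)\<close>, which
  costs an error proportional to \<open>\<eta>\<close>. Three instances are used: the rate \<open>\<epsilon>\<close> of the theorem gives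
  stability, \<open>\<epsilon> = 0\<close> an \<open>L\<^sup>1\<close>-bound and uniqueness for the linear equation, and \<open>\<epsilon> = c\<close> a pointwise bound.\<close>
lemma exp_weighted_abs_le_integral:
  fixes w \<delta> h :: "real \<Rightarrow> real"
  assumes "0 \<le> T" "0 \<le> c" "0 \<le> \<epsilon>"
    and cont: "continuous_on {0..} h"
    and dissip: "\<And>t. 0 \<le> t \<Longrightarrow> c \<le> \<delta> t"
    and deriv: "\<And>t. 0 \<le> t \<Longrightarrow> (w has_real_derivative (- \<delta> t * w t + h t)) (at t within {0..})"
  shows "exp (\<epsilon> * T) * \<bar>w T\<bar> - \<bar>w 0\<bar>
    \<le> integral {0..T} (\<lambda>s. exp (\<epsilon> * s) * ((\<epsilon> - c) * \<bar>w s\<bar> + \<bar>h s\<bar>))"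
proof -
  let ?q = "\<lambda>s. exp (\<epsilon> * s) * ((\<epsilon> - c) * \<bar>w s\<bar> + \<bar>h s\<bar>)"
  (* M * \<eta> absorbs both the error in the integrand over [0,T] and the error \<eta> at time 0. *)
  define M where "M = (\<epsilon> + c) * exp (\<epsilon> * T) * T + 1"
  have "0 \<le> (\<epsilon> + c) * exp (\<epsilon> * T) * T"
    using assms(1-3) by simp
  then have M: "M > 0"
    by (simp add: M_def)
  have w_cont: "continuous_on {0..} w"
    by (rule DERIV_continuous_on) (use deriv in auto)
  have q_cont: "continuous_on {0..T} ?q"
    by (intro continuous_intros continuous_on_subset[OF w_cont] continuous_on_subset[OF cont]) auto
  have approx: "exp (\<epsilon> * T) * \<bar>w T\<bar> - \<bar>w 0\<bar> \<le> integral {0..T} ?q + M * \<eta>" if \<eta>: "\<eta> > 0" for \<eta>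
  proof -
    define r where "r = (\<lambda>s. sqrt ((w s)\<^sup>2 + \<eta>\<^sup>2))"
    have r_pos: "r s > 0" and r_ge: "\<bar>w s\<bar> \<le> r s" and r_le: "r s \<le> \<bar>w s\<bar> + \<eta>"
      and r_sq: "(r s)\<^sup>2 = (w s)\<^sup>2 + \<eta>\<^sup>2" for s
    proof -
      show "r s > 0" using \<eta> unfolding r_def by (simp add: add_nonneg_pos)
      show "\<bar>w s\<bar> \<le> r s" unfolding r_def by (rule real_le_rsqrt) simp
      show "r s \<le> \<bar>w s\<bar> + \<eta>" unfolding r_def
        by (rule real_le_lsqrt) (use \<eta> in \<open>auto simp: power2_sum\<close>)
      show "(r s)\<^sup>2 = (w s)\<^sup>2 + \<eta>\<^sup>2" unfolding r_def by simp
    qed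
    let ?R = "\<lambda>s. exp (\<epsilon> * s) * (\<epsilon> * r s + w s * (- \<delta> s * w s + h s) / r s)"
    have r_deriv: "((\<lambda>s. exp (\<epsilon> * s) * r s) has_real_derivative ?R s) (at s within {0..T})"
      if "s \<in> {0..T}" for s
    proof -
      define w' where "w' = - \<delta> s * w s + h s"
      have w_deriv: "(w has_real_derivative w') (at s within {0..T})"
        unfolding w'_def using that by (intro has_field_derivative_subset[OF deriv]) auto
      have "0 < (w s)\<^sup>2 + \<eta>\<^sup>2"
        using \<eta> by (simp add: add_nonneg_pos)
      then have "(r has_real_derivative (w s * w' / r s)) (at s within {0..T})"
        unfolding r_def
        by (auto intro!: derivative_eq_intros w_deriv simp: field_simps)
      then show ?thesis
        unfolding w'_def[symmetric]
        by (auto intro!: derivative_eq_intros simp: algebra_simps)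
    qed
    have "(?R has_integral (exp (\<epsilon> * T) * r T - exp (\<epsilon> * 0) * r 0)) {0..T}"
      using r_deriv assms(1)
      by (intro fundamental_theorem_of_calculus) (auto simp: has_real_derivative_iff_has_vector_derivative)
    moreover have "((\<lambda>s. ?q s + (\<epsilon> + c) * exp (\<epsilon> * T) * \<eta>) has_integral
        (integral {0..T} ?q + T * ((\<epsilon> + c) * exp (\<epsilon> * T) * \<eta>))) {0..T}"
      using has_integral_const_real[of "(\<epsilon> + c) * exp (\<epsilon> * T) * \<eta>" 0 T] assms(1)
      by (intro has_integral_add integrable_integral integrable_continuous_real q_cont) simp
    moreover have "?R s \<le> ?q s + (\<epsilon> + c) * exp (\<epsilon> * T) * \<eta>" if s: "s \<in> {0..T}" for s
    proof -
      (* The damping term of the regularised derivative loses only \<eta> against its formal value. *)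
      have "(\<bar>w s\<bar> - \<eta>) * r s \<le> (w s)\<^sup>2"
      proof (cases "\<bar>w s\<bar> \<le> \<eta>")
        case True
        then have "(\<bar>w s\<bar> - \<eta>) * r s \<le> 0"
          using r_pos[of s] by (intro mult_nonpos_nonneg) auto
        then show ?thesis by (smt (verit) zero_le_power2)
      next
        case False
        then have "(\<bar>w s\<bar> - \<eta>) * r s \<le> (\<bar>w s\<bar> - \<eta>) * (\<bar>w s\<bar> + \<eta>)"
          using r_le[of s] by (intro mult_left_mono) auto
        also have "\<dots> = (w s)\<^sup>2 - \<eta>\<^sup>2"
          by (simp add: algebra_simps power2_eq_square abs_mult[symmetric])
        finally show ?thesis using zero_le_power2[of \<eta>] by linarith
      qed
      then have 1: "\<bar>w s\<bar> - \<eta> \<le> (w s)\<^sup>2 / r s"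
        using r_pos[of s] by (simp add: field_simps)
      have "c * (\<bar>w s\<bar> - \<eta>) \<le> c * ((w s)\<^sup>2 / r s)"
        using 1 assms(2) by (rule mult_left_mono)
      also have "\<dots> \<le> \<delta> s * ((w s)\<^sup>2 / r s)"
        using dissip[of s] s r_pos[of s] by (intro mult_right_mono) auto
      finally have 2: "- \<delta> s * ((w s)\<^sup>2 / r s) \<le> - c * \<bar>w s\<bar> + c * \<eta>"
        by (simp add: algebra_simps)
      have "w s * h s / r s \<le> \<bar>w s\<bar> * \<bar>h s\<bar> / r s"
        using r_pos[of s] by (intro divide_right_mono) (auto simp flip: abs_mult)
      also have "\<dots> \<le> r s * \<bar>h s\<bar> / r s"
        using r_pos[of s] r_ge[of s] by (intro divide_right_mono mult_right_mono) auto
      finally have 3: "w s * h s / r s \<le> \<bar>h s\<bar>"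
        using r_pos[of s] by simp
      have 4: "\<epsilon> * r s \<le> \<epsilon> * \<bar>w s\<bar> + \<epsilon> * \<eta>"
        using mult_left_mono[OF r_le assms(3)] by (simp add: algebra_simps)
      have "\<epsilon> * r s + w s * (- \<delta> s * w s + h s) / r s
          = \<epsilon> * r s + - \<delta> s * ((w s)\<^sup>2 / r s) + w s * h s / r s"
        by (simp add: algebra_simps power2_eq_square add_divide_distrib diff_divide_distrib)
      also have "\<dots> \<le> (\<epsilon> - c) * \<bar>w s\<bar> + \<bar>h s\<bar> + (\<epsilon> + c) * \<eta>"
        using 2 3 4 by (simp add: algebra_simps)
      finally have "?R s \<le> exp (\<epsilon> * s) * ((\<epsilon> - c) * \<bar>w s\<bar> + \<bar>h s\<bar> + (\<epsilon> + c) * \<eta>)"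
        by (intro mult_left_mono) auto
      also have "\<dots> = ?q s + exp (\<epsilon> * s) * ((\<epsilon> + c) * \<eta>)"
        by (simp add: algebra_simps)
      also have "\<dots> \<le> ?q s + exp (\<epsilon> * T) * ((\<epsilon> + c) * \<eta>)"
        using s assms(2,3) \<eta> by (intro add_left_mono mult_right_mono) (auto intro: mult_left_mono)
      finally show ?thesis by (simp add: algebra_simps)
    qed
    ultimately have "exp (\<epsilon> * T) * r T - exp (\<epsilon> * 0) * r 0
        \<le> integral {0..T} ?q + T * ((\<epsilon> + c) * exp (\<epsilon> * T) * \<eta>)"
      by (rule has_integral_le) 
    then have "exp (\<epsilon> * T) * r T - r 0 \<le> integral {0..T} ?q + (M - 1) * \<eta>"
      by (simp add: M_def algebra_simps)
    moreover have "exp (\<epsilon> * T) * \<bar>w T\<bar> \<le> exp (\<epsilon> * T) * r T"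
      using r_ge by simp
    ultimately show ?thesis
      using r_le[of 0] by (simp only: left_diff_distrib)
  qed
  show ?thesis
  proof (rule field_le_epsilon)
    fix e :: real assume "e > 0"
    then show "exp (\<epsilon> * T) * \<bar>w T\<bar> - \<bar>w 0\<bar> \<le> integral {0..T} ?q + e"
      using approx[of "e / M"] M by simp
  qed
qed

lemma integral_atLeast0_has_real_derivative:
  fixes q :: "real \<Rightarrow> real"
  assumes "continuous_on {0..} q" "0 \<le> t"
  shows "((\<lambda>x. integral {0..x} q) has_real_derivative q t) (at t within {0..})"
proof -
  have "((\<lambda>x. integral {0..x} q) has_real_derivative q t) (at t within {0..t + 1})"
    using assms by (intro integral_has_real_derivative continuous_on_subset[OF assms(1)]) auto
  moreover have "at t within {0..t + 1} = at t within {0..}"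
    by (rule at_within_nhd[where S = "{..<t + 1}"]) auto
  ultimately show ?thesis by simp
qed

text \<open>Variation of constants, with the initial value chosen such that the solution
  returns to it after one period; this is possible because the homogeneous equation contracts by the factor
  \<open>exp (- D \<omega>) < 1\<close>. Two solutions with the same initial value agree, so the translate by \<open>\<omega>\<close> is
  the solution itself.\<close>
lemma linear_periodic_solution_exists:
  fixes \<delta> h :: "real \<Rightarrow> real"
  assumes "\<omega> > 0" "c > 0"
    and \<delta>: "continuous_periodic \<omega> \<delta>" and h: "continuous_periodic \<omega> h"
    and dissip: "\<And>t. 0 \<le> t \<Longrightarrow> c \<le> \<delta> t"
  shows "\<exists>v. continuous_on UNIV v \<and> (\<forall>t. v (t + \<omega>) = v t) \<and>
    (\<forall>t\<ge>0. (v has_real_derivative (- \<delta> t * v t + h t)) (at t within {0..}))"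
proof -
  have \<delta>_cont: "continuous_on {0..} \<delta>" and \<delta>_per: "\<And>t. 0 \<le> t \<Longrightarrow> \<delta> (t + \<omega>) = \<delta> t"
    and h_cont: "continuous_on {0..} h" and h_per: "\<And>t. 0 \<le> t \<Longrightarrow> h (t + \<omega>) = h t"
    using \<delta> h by (auto simp: continuous_periodic_def)
  define D where "D = (\<lambda>t. integral {0..t} \<delta>)"
  have D_deriv: "(D has_real_derivative \<delta> t) (at t within {0..})" if "0 \<le> t" for t
    unfolding D_def using \<delta>_cont that by (rule integral_atLeast0_has_real_derivative)
  have D_cont: "continuous_on {0..} D"
    by (rule DERIV_continuous_on) (use D_deriv in auto)
  define H where "H = (\<lambda>t. integral {0..t} (\<lambda>s. exp (D s) * h s))"
  have H_deriv: "(H has_real_derivative exp (D t) * h t) (at t within {0..})" if "0 \<le> t" for t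
    unfolding H_def using that
    by (intro integral_atLeast0_has_real_derivative continuous_intros D_cont h_cont)
  have "c * \<omega> = integral {0..\<omega>} (\<lambda>_. c)" using assms(1) by simp
  also have "\<dots> \<le> D \<omega>" unfolding D_def
    using dissip by (intro integral_le integrable_continuous_real continuous_on_subset[OF \<delta>_cont]) auto
  finally have D\<omega>: "D \<omega> > 0" using assms(1,2) by (smt (verit) mult_pos_pos)
  (* H \<omega> / (exp (D \<omega>) - 1) is the solution x of exp (- D \<omega>) * (x + H \<omega>) = x. *)
  define v0 where "v0 = (\<lambda>t. exp (- D t) * (H \<omega> / (exp (D \<omega>) - 1) + H t))"
  have v0_deriv: "(v0 has_real_derivative (- \<delta> t * v0 t + h t)) (at t within {0..})"
    if "0 \<le> t" for t
  proof -
    have "(v0 has_real_derivative (exp (- D t) * (- \<delta> t) * (H \<omega> / (exp (D \<omega>) - 1) + H t)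
        + exp (- D t) * (exp (D t) * h t))) (at t within {0..})"
      unfolding v0_def
      by (rule derivative_eq_intros D_deriv[OF that] H_deriv[OF that] refl)+ simp
    moreover have "exp (- D t) * (exp (D t) * h t) = h t"
      by (simp add: exp_minus)
    ultimately show ?thesis by (simp only: v0_def mult.assoc mult.left_commute mult_minus_left mult_minus_right)
  qed
  have "v0 \<omega> = v0 0"
  proof -
    have "D 0 = 0" "H 0 = 0" by (simp_all add: D_def H_def)
    then show ?thesis using D\<omega> by (simp add: v0_def exp_minus field_simps)
  qed
  have v0_per: "v0 (t + \<omega>) = v0 t" if "0 \<le> t" for t
  proof -
    define z where "z = (\<lambda>t. v0 (t + \<omega>) - v0 t)"
    have z_deriv: "(z has_real_derivative (- \<delta> s * z s + 0)) (at s within {0..})" if "0 \<le> s" for s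
    proof -
      have "(v0 has_real_derivative (- \<delta> (s + \<omega>) * v0 (s + \<omega>) + h (s + \<omega>)))
          (at (s + \<omega>) within (\<lambda>x. x + \<omega>) ` {0..})"
        using that assms(1) by (intro has_field_derivative_subset[OF v0_deriv]) auto
      moreover have "((\<lambda>x. x + \<omega>) has_real_derivative 1) (at s within {0..})"
        by (auto intro!: derivative_eq_intros)
      ultimately have "(v0 \<circ> (\<lambda>x. x + \<omega>) has_real_derivative
          (- \<delta> (s + \<omega>) * v0 (s + \<omega>) + h (s + \<omega>)) * 1) (at s within {0..})"
        by (rule DERIV_image_chain)
      from DERIV_diff[OF this v0_deriv[OF that]] show ?thesis
        using \<delta>_per[OF that] h_per[OF that] by (simp add: z_def o_def algebra_simps)
    qed
    have z_cont: "continuous_on {0..} z"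
      by (rule DERIV_continuous_on) (use z_deriv in auto)
    have "exp (0 * t) * \<bar>z t\<bar> - \<bar>z 0\<bar>
        \<le> integral {0..t} (\<lambda>s. exp (0 * s) * ((0 - c) * \<bar>z s\<bar> + \<bar>0\<bar>))"
      using assms(2) dissip that z_deriv by (intro exp_weighted_abs_le_integral[where \<delta> = \<delta>]) auto
    also have "\<dots> \<le> 0"
    proof -
      have "0 \<le> integral {0..t} (\<lambda>s. c * \<bar>z s\<bar>)"
        using assms(2) by (intro Henstock_Kurzweil_Integration.integral_nonneg integrable_continuous_real
            continuous_intros continuous_on_subset[OF z_cont]) auto
      then show ?thesis by simp
    qed
    finally show ?thesis using \<open>v0 \<omega> = v0 0\<close> by (simp add: z_def)
  qed
  have v0_cont: "continuous_on {0..} v0"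
    by (rule DERIV_continuous_on) (use v0_deriv in auto)
  let ?v = "periodic_ext \<omega> v0"
  have eq: "?v t = v0 t" if "0 \<le> t" for t
    using assms(1) v0_per that by (rule periodic_ext_eq)
  have "(?v has_real_derivative (- \<delta> t * ?v t + h t)) (at t within {0..})" if "0 \<le> t" for t
    by (rule has_field_derivative_transform_within[where f = v0 and d = 1])
      (use that v0_deriv[OF that] in \<open>auto simp: eq\<close>)
  moreover have "continuous_on UNIV ?v"
    using assms(1) v0_per v0_cont by (rule continuous_on_periodic_ext)
  moreover have "\<forall>t. ?v (t + \<omega>) = ?v t"
    using assms(1) by (simp add: periodic_ext_plus)
  ultimately show ?thesis by blast
qed

text \<open>Over one period the boundary terms cancel, which leaves only the comparison of damping and forcing.\<close>
lemma periodic_solution_L1_le: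
  fixes w \<delta> h :: "real \<Rightarrow> real"
  assumes "\<omega> > 0" "c > 0"
    and "continuous_on {0..} h"
    and "\<And>t. 0 \<le> t \<Longrightarrow> c \<le> \<delta> t"
    and deriv: "\<And>t. 0 \<le> t \<Longrightarrow> (w has_real_derivative (- \<delta> t * w t + h t)) (at t within {0..})"
    and per: "\<And>t. w (t + \<omega>) = w t"
  shows "c * integral {0..\<omega>} (\<lambda>t. \<bar>w t\<bar>) \<le> integral {0..\<omega>} (\<lambda>t. \<bar>h t\<bar>)"
proof -
  have w_cont: "continuous_on {0..} w"
    by (rule DERIV_continuous_on) (use deriv in auto)
  have int: "(\<lambda>t. \<bar>w t\<bar>) integrable_on {0..\<omega>}" "(\<lambda>t. \<bar>h t\<bar>) integrable_on {0..\<omega>}"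
    by (auto intro!: integrable_continuous_real continuous_intros continuous_on_subset[OF w_cont]
        continuous_on_subset[OF assms(3)])
  have "0 = exp (0 * \<omega>) * \<bar>w \<omega>\<bar> - \<bar>w 0\<bar>"
    using per[of 0] by simp
  also have "\<dots> \<le> integral {0..\<omega>} (\<lambda>s. exp (0 * s) * ((0 - c) * \<bar>w s\<bar> + \<bar>h s\<bar>))"
    using assms by (intro exp_weighted_abs_le_integral[where \<delta> = \<delta>]) auto
  also have "\<dots> = integral {0..\<omega>} (\<lambda>s. \<bar>h s\<bar> - c * \<bar>w s\<bar>)"
    by simp
  also have "\<dots> = integral {0..\<omega>} (\<lambda>s. \<bar>h s\<bar>) - c * integral {0..\<omega>} (\<lambda>s. \<bar>w s\<bar>)"
    using int by (subst Henstock_Kurzweil_Integration.integral_diff) (auto intro: integrable_on_mult_right)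
  finally show ?thesis by simp
qed

text \<open>With weight \<open>exp (c * t)\<close> the damping disappears from the integral. Over a full period this bounds
  \<open>\<bar>w 0\<bar>\<close>, since \<open>w \<omega> = w 0\<close>, and from there every value within the period.\<close>
lemma periodic_solution_sup_le:
  fixes w \<delta> h :: "real \<Rightarrow> real"
  assumes "\<omega> > 0" "c > 0"
    and h_cont: "continuous_on {0..} h"
    and dissip: "\<And>t. 0 \<le> t \<Longrightarrow> c \<le> \<delta> t"
    and deriv: "\<And>t. 0 \<le> t \<Longrightarrow> (w has_real_derivative (- \<delta> t * w t + h t)) (at t within {0..})"
    and per: "\<And>t. w (t + \<omega>) = w t"
  shows "\<bar>w t\<bar> \<le> exp (c * \<omega>) * (1 + 1 / (exp (c * \<omega>) - 1)) * integral {0..\<omega>} (\<lambda>t. \<bar>h t\<bar>)"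
proof -
  let ?N = "integral {0..\<omega>} (\<lambda>t. \<bar>h t\<bar>)"
  have h_int: "(\<lambda>t. \<bar>h t\<bar>) integrable_on {0..x}" for x
    by (auto intro!: integrable_continuous_real continuous_intros continuous_on_subset[OF h_cont])
  have bound: "exp (c * T) * \<bar>w T\<bar> - \<bar>w 0\<bar> \<le> exp (c * \<omega>) * ?N" if "0 \<le> T" "T \<le> \<omega>" for T
  proof -
    have "exp (c * T) * \<bar>w T\<bar> - \<bar>w 0\<bar>
        \<le> integral {0..T} (\<lambda>s. exp (c * s) * ((c - c) * \<bar>w s\<bar> + \<bar>h s\<bar>))"
      using assms that by (intro exp_weighted_abs_le_integral[where \<delta> = \<delta>]) auto
    also have "\<dots> = integral {0..T} (\<lambda>s. exp (c * s) * \<bar>h s\<bar>)" by simp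
    also have "\<dots> \<le> integral {0..T} (\<lambda>s. exp (c * \<omega>) * \<bar>h s\<bar>)"
      using assms(2) that
      by (intro integral_le integrable_continuous_real continuous_intros
          continuous_on_subset[OF h_cont] mult_right_mono) auto
    also have "\<dots> = exp (c * \<omega>) * integral {0..T} (\<lambda>s. \<bar>h s\<bar>)" by simp
    also have "\<dots> \<le> exp (c * \<omega>) * ?N"
      using that h_int by (intro mult_left_mono integral_subset_le) auto
    finally show ?thesis .
  qed
  have e: "exp (c * \<omega>) > 1" using assms(1,2) by simp
  have "exp (c * \<omega>) * \<bar>w 0\<bar> - \<bar>w 0\<bar> \<le> exp (c * \<omega>) * ?N"
    using bound[of \<omega>] per[of 0] assms(1) by simp
  then have w0: "\<bar>w 0\<bar> \<le> exp (c * \<omega>) * ?N / (exp (c * \<omega>) - 1)"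
    using e by (simp add: field_simps)
  define r where "r = t - \<omega> * of_int \<lfloor>t / \<omega>\<rfloor>"
  have r: "0 \<le> r" "r \<le> \<omega>"
    using diff_floor_multiple_bounds[OF assms(1), of t] by (auto simp: r_def)
  have "w t = w r"
    using periodic_ext_eq_self[of \<omega> w t] assms(1) per by (simp add: periodic_ext_def r_def)
  moreover have "1 * \<bar>w r\<bar> \<le> exp (c * r) * \<bar>w r\<bar>"
    using r assms(2) by (intro mult_right_mono) auto
  ultimately have "\<bar>w t\<bar> \<le> exp (c * \<omega>) * ?N + exp (c * \<omega>) * ?N / (exp (c * \<omega>) - 1)"
    using bound[OF r] w0 by linarith
  then show ?thesis by (simp add: algebra_simps)
qed

section \<open>Lipschitz classes\<close>

lemma class_H_lipschitz:
  assumes "k \<in> class_H L" "L i > 0"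
  shows "\<bar>k i x - k i y\<bar> \<le> L i * \<bar>x - y\<bar>"
proof (cases "x = y")
  case False
  have "\<forall>i y u. u \<noteq> 0 \<longrightarrow> \<bar>k i (y + u) - k i y\<bar> / \<bar>u\<bar> \<le> L i"
    using assms(1) by (simp add: class_H_def)
  from this[rule_format, of "x - y" i y] have "\<bar>k i x - k i y\<bar> / \<bar>x - y\<bar> \<le> L i"
    using False by simp
  then show ?thesis using False by (simp add: field_simps)
qed simp

lemma class_H_continuous:
  assumes "k \<in> class_H L" "L i > 0"
  shows "continuous_on UNIV (k i)"
  using class_H_lipschitz[OF assms] assms(2)
  by (intro lipschitz_on_continuous_on[of "L i"] lipschitz_onI) (auto simp: dist_real_def)

section \<open>The delayed system as a forced linear system\<close>

locale periodic_delay_system =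
  fixes \<omega> :: real
    and d :: "'n::finite \<Rightarrow> real \<Rightarrow> real"
    and d0 :: "'n \<Rightarrow> real"
    and a b :: "'n \<Rightarrow> 'n \<Rightarrow> real \<Rightarrow> real"
    and I :: "'n \<Rightarrow> real \<Rightarrow> real"
    and \<tau> :: "'n \<Rightarrow> 'n \<Rightarrow> real"
    and g f :: "'n \<Rightarrow> real \<Rightarrow> real"
    and G F :: "'n \<Rightarrow> real"
  assumes period_pos: "\<omega> > 0"
    and delay_nonneg: "\<And>i j. \<tau> i j \<ge> 0"
    and d_periodic: "\<And>i. continuous_periodic \<omega> (d i)"
    and a_periodic: "\<And>i j. continuous_periodic \<omega> (a i j)"
    and b_periodic: "\<And>i j. continuous_periodic \<omega> (b i j)"
    and I_periodic: "\<And>i. continuous_periodic \<omega> (I i)"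
    and d0_pos: "\<And>i. d0 i > 0"
    and d0_le: "\<And>i t. t \<ge> 0 \<Longrightarrow> d0 i \<le> d i t"
    and G_pos: "\<And>i. G i > 0"
    and F_pos: "\<And>i. F i > 0"
    and g_class: "g \<in> class_H G"
    and f_class: "f \<in> class_H F"
begin

abbreviation "A i j \<equiv> period_sup \<omega> (a i j)"
abbreviation "B i j \<equiv> period_sup \<omega> (b i j)"

text \<open>Everything on the right-hand side except the damping. The solution enters the forcing only through
  Lipschitz functions, and the damping acts on each component separately.\<close>
definition forcing :: "(real \<Rightarrow> real ^ 'n) \<Rightarrow> 'n \<Rightarrow> real \<Rightarrow> real" where
  "forcing \<phi> i t = (\<Sum>j\<in>UNIV. a i j t * g j (\<phi> t $ j))
     + (\<Sum>j\<in>UNIV. b i j t * f j (\<phi> (t - \<tau> i j) $ j)) + I i t"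

lemma delay_rhs_eq: "delay_rhs d a b I \<tau> g f u i t = - d i t * u t $ i + forcing u i t"
  by (simp add: delay_rhs_def forcing_def)

lemma delay_le_max_delay: "\<tau> i j \<le> max_delay \<tau>"
  unfolding max_delay_def by (intro Max_ge) (auto intro: image_eqI[where x = "(i, j)"])

lemma max_delay_nonneg: "0 \<le> max_delay \<tau>"
  using delay_le_max_delay delay_nonneg by (meson order_trans)

lemma A_nonneg: "0 \<le> A i j" and B_nonneg: "0 \<le> B i j"
  using abs_le_period_sup[OF period_pos a_periodic, of 0 i j]
    abs_le_period_sup[OF period_pos b_periodic, of 0 i j] by auto

lemma forcing_diff_le:
  assumes "0 \<le> t"
  shows "\<bar>forcing \<phi> i t - forcing \<psi> i t\<bar>
    \<le> (\<Sum>j\<in>UNIV. A i j * G j * \<bar>\<phi> t $ j - \<psi> t $ j\<bar>)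
      + (\<Sum>j\<in>UNIV. B i j * F j * \<bar>\<phi> (t - \<tau> i j) $ j - \<psi> (t - \<tau> i j) $ j\<bar>)"
proof -
  let ?a = "\<lambda>j. a i j t * (g j (\<phi> t $ j) - g j (\<psi> t $ j))"
  let ?b = "\<lambda>j. b i j t * (f j (\<phi> (t - \<tau> i j) $ j) - f j (\<psi> (t - \<tau> i j) $ j))"
  have a: "\<bar>?a j\<bar> \<le> A i j * G j * \<bar>\<phi> t $ j - \<psi> t $ j\<bar>" for j
    using mult_mono[OF abs_le_period_sup[OF period_pos a_periodic assms]
        class_H_lipschitz[where k = g, OF g_class G_pos] A_nonneg abs_ge_zero]
    by (simp add: abs_mult mult.assoc)
  have b: "\<bar>?b j\<bar> \<le> B i j * F j * \<bar>\<phi> (t - \<tau> i j) $ j - \<psi> (t - \<tau> i j) $ j\<bar>" for j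
    using mult_mono[OF abs_le_period_sup[OF period_pos b_periodic assms]
        class_H_lipschitz[where k = f, OF f_class F_pos] B_nonneg abs_ge_zero]
    by (simp add: abs_mult mult.assoc)
  have "forcing \<phi> i t - forcing \<psi> i t = sum ?a UNIV + sum ?b UNIV"
    by (simp add: forcing_def right_diff_distrib sum_subtractf)
  moreover have "\<bar>sum ?a UNIV + sum ?b UNIV\<bar> \<le> \<bar>sum ?a UNIV\<bar> + \<bar>sum ?b UNIV\<bar>"
    by (rule abs_triangle_ineq)
  moreover have "\<bar>sum ?a UNIV\<bar> \<le> (\<Sum>j\<in>UNIV. A i j * G j * \<bar>\<phi> t $ j - \<psi> t $ j\<bar>)"
    by (rule sum_abs[THEN order_trans]) (rule sum_mono[OF a])
  moreover have "\<bar>sum ?b UNIV\<bar>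
      \<le> (\<Sum>j\<in>UNIV. B i j * F j * \<bar>\<phi> (t - \<tau> i j) $ j - \<psi> (t - \<tau> i j) $ j\<bar>)"
    by (rule sum_abs[THEN order_trans]) (rule sum_mono[OF b])
  ultimately show ?thesis by linarith
qed

lemma continuous_on_forcing:
  assumes "continuous_on {- max_delay \<tau>..} \<phi>"
  shows "continuous_on {0..} (forcing \<phi> i)"
proof -
  have comp: "continuous_on {0..} (\<lambda>t. k j (\<phi> (t - s) $ j))"
    if "k \<in> class_H L" "L j > 0" "s \<le> max_delay \<tau>" for k L j s
    by (intro continuous_on_compose2[OF class_H_continuous[OF that(1,2)]] continuous_intros
        continuous_on_compose2[OF assms]) (use that(3) in auto)
  have a: "continuous_on {0..} (a i j)" and b: "continuous_on {0..} (b i j)"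
    and I: "continuous_on {0..} (I i)" for j
    using a_periodic b_periodic I_periodic by (auto simp: continuous_periodic_def)
  show ?thesis
    unfolding forcing_def
    using comp[OF g_class G_pos, of 0] comp[OF f_class F_pos] delay_le_max_delay max_delay_nonneg
    by (intro continuous_intros a b I) auto
qed

lemma forcing_periodic:
  assumes "continuous_on UNIV \<phi>" "\<And>t. \<phi> (t + \<omega>) = \<phi> t"
  shows "continuous_periodic \<omega> (forcing \<phi> i)"
proof -
  have "\<phi> (t + \<omega> - s) = \<phi> (t - s)" for t s
    using assms(2)[of "t - s"] by (simp add: algebra_simps)
  then have "forcing \<phi> i (t + \<omega>) = forcing \<phi> i t" if "0 \<le> t" for t
    using that a_periodic b_periodic I_periodic assms(2)
    by (simp add: forcing_def continuous_periodic_def)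
  then show ?thesis
    using continuous_on_forcing continuous_on_subset[OF assms(1)] by (auto simp: continuous_periodic_def)
qed

text \<open>The Picard step as a relation: \<open>\<psi>\<close> is a periodic solution of the linear system that
  arises when \<open>\<phi>\<close> is inserted into the forcing.\<close>
definition periodic_response :: "(real \<Rightarrow> real ^ 'n) \<Rightarrow> (real \<Rightarrow> real ^ 'n) \<Rightarrow> bool" where
  "periodic_response \<phi> \<psi> \<longleftrightarrow> continuous_on UNIV \<psi> \<and> (\<forall>t. \<psi> (t + \<omega>) = \<psi> t) \<and>
     (\<forall>i. \<forall>t\<ge>0. ((\<lambda>s. \<psi> s $ i) has_real_derivative (- d i t * \<psi> t $ i + forcing \<phi> i t))
                    (at t within {0..}))"

lemma periodic_response_exists:
  assumes "continuous_on UNIV \<phi>" "\<And>t. \<phi> (t + \<omega>) = \<phi> t"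
  shows "\<exists>\<psi>. periodic_response \<phi> \<psi>"
proof -
  have "\<forall>i. \<exists>v. continuous_on UNIV v \<and> (\<forall>t. v (t + \<omega>) = v t) \<and>
      (\<forall>t\<ge>0. (v has_real_derivative (- d i t * v t + forcing \<phi> i t)) (at t within {0..}))"
    using linear_periodic_solution_exists[OF period_pos d0_pos d_periodic forcing_periodic] assms d0_le
    by blast
  then obtain v where v: "\<And>i. continuous_on UNIV (v i)" "\<And>i t. v i (t + \<omega>) = v i t"
    "\<And>i t. t \<ge> 0 \<Longrightarrow> (v i has_real_derivative (- d i t * v i t + forcing \<phi> i t)) (at t within {0..})"
    by metis
  have "periodic_response \<phi> (\<lambda>t. \<chi> i. v i t)"
    unfolding periodic_response_def using v by (auto intro!: continuous_on_vec_lambda)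
  then show ?thesis by blast
qed

lemma periodic_response_self_imp_solution:
  assumes "periodic_response v v"
  shows "periodic_delay_solution \<omega> d a b I \<tau> g f v"
  using assms continuous_on_subset[of UNIV v]
  by (auto simp: periodic_response_def periodic_delay_solution_def delay_solution_def delay_rhs_eq)

lemma damped_difference_deriv:
  assumes "((\<lambda>s. u s $ i) has_real_derivative (- d i t * u t $ i + p)) (at t within S)"
    "((\<lambda>s. v s $ i) has_real_derivative (- d i t * v t $ i + q)) (at t within S)"
  shows "((\<lambda>s. u s $ i - v s $ i) has_real_derivative
    (- d i t * (u t $ i - v t $ i) + (p - q))) (at t within S)"
  using DERIV_diff[OF assms] by (simp add: algebra_simps)

end

section \<open>Exponential stability\<close>

locale dominated_delay_system = periodic_delay_system \<omega> d d0 a b I \<tau> g f G F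
  for \<omega> and d :: "'n::finite \<Rightarrow> real \<Rightarrow> real" and d0 a b I \<tau> g f G F +
  fixes \<epsilon> :: real and \<theta> :: "'n \<Rightarrow> real"
  assumes rate_pos: "\<epsilon> > 0"
    and weight_pos: "\<And>i. \<theta> i > 0"
    and dominance: "\<And>j. (- d0 j + \<epsilon>) * \<theta> j + G j * (\<Sum>i\<in>UNIV. \<theta> i * A i j)
       + F j * (\<Sum>i\<in>UNIV. \<theta> i * B i j * exp (\<epsilon> * \<tau> i j)) \<le> 0"
begin

text \<open>Interchanging the two summations turns the rows of the system into the columns to which the dominance
  hypothesis applies. Both the stability estimate and the contraction estimate end here, with \<open>X j\<close>
  the integral of the \<open>j\<close>-th component of a difference.\<close>
lemma weighted_coupling_le:
  assumes "\<And>j. 0 \<le> X j"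
  shows "(\<Sum>i\<in>UNIV. \<theta> i * ((\<Sum>j\<in>UNIV. A i j * G j * X j)
      + (\<Sum>j\<in>UNIV. B i j * F j * exp (\<epsilon> * \<tau> i j) * X j))) \<le> (\<Sum>j\<in>UNIV. (d0 j - \<epsilon>) * \<theta> j * X j)"
proof -
  have "(\<Sum>i\<in>UNIV. \<theta> i * ((\<Sum>j\<in>UNIV. A i j * G j * X j)
      + (\<Sum>j\<in>UNIV. B i j * F j * exp (\<epsilon> * \<tau> i j) * X j)))
      = (\<Sum>i\<in>UNIV. \<Sum>j\<in>UNIV. \<theta> i * (A i j * G j + B i j * F j * exp (\<epsilon> * \<tau> i j)) * X j)"
    by (simp add: sum_distrib_left sum.distrib algebra_simps)
  also have "\<dots> = (\<Sum>j\<in>UNIV. \<Sum>i\<in>UNIV. \<theta> i * (A i j * G j + B i j * F j * exp (\<epsilon> * \<tau> i j)) * X j)"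
    by (rule sum.swap)
  also have "\<dots> = (\<Sum>j\<in>UNIV. (G j * (\<Sum>i\<in>UNIV. \<theta> i * A i j)
      + F j * (\<Sum>i\<in>UNIV. \<theta> i * B i j * exp (\<epsilon> * \<tau> i j))) * X j)"
    by (simp add: sum_distrib_left sum_distrib_right sum.distrib algebra_simps)
  also have "\<dots> \<le> (\<Sum>j\<in>UNIV. (d0 j - \<epsilon>) * \<theta> j * X j)"
    using dominance assms by (intro sum_mono mult_right_mono) (auto simp: algebra_simps)
  finally show ?thesis .
qed

text \<open>Write \<open>y i t = exp (\<epsilon> * t) * \<bar>u t $ i - v t $ i\<bar>\<close>. The delayed term with delay \<open>\<tau> i j\<close> contributes
  the factor \<open>exp (\<epsilon> * \<tau> i j)\<close> and the integral of \<open>y j\<close> over a shifted interval, which is at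
  most the integral \<open>Y j\<close> over \<open>[0,T]\<close> plus the integral \<open>P j\<close> over the initial interval. After
  weighting and summing, the total coefficient of the \<open>Y j\<close> is nonpositive, so that only the
  constant made of the \<open>P j\<close> and the values at time 0 remains.\<close>
lemma solutions_approach_exponentially:
  assumes u: "delay_solution d a b I \<tau> g f u" and v: "delay_solution d a b I \<tau> g f v"
  obtains C where "\<And>i t. 0 \<le> t \<Longrightarrow> \<bar>u t $ i - v t $ i\<bar> \<le> C * exp (- \<epsilon> * t)"
proof -
  let ?m = "max_delay \<tau>"
  define x where "x = (\<lambda>i t. \<bar>u t $ i - v t $ i\<bar>)"
  define y where "y = (\<lambda>i t. exp (\<epsilon> * t) * x i t)"
  have u_cont: "continuous_on {-?m..} u" and v_cont: "continuous_on {-?m..} v"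
    using u v by (auto simp: delay_solution_def)
  have y_cont: "continuous_on {-?m..} (y i)" for i
    unfolding y_def x_def by (intro continuous_intros u_cont v_cont)
  have y_nonneg: "0 \<le> y i t" for i t by (simp add: y_def x_def)
  have y_int: "y i integrable_on {p..q}" if "- ?m \<le> p" for i p q
    using that by (intro integrable_continuous_real continuous_on_subset[OF y_cont]) auto
  define P where "P = (\<lambda>j. integral {-?m..0} (y j))"
  define C where "C = (\<Sum>i\<in>UNIV. \<theta> i * (x i 0 + (\<Sum>j\<in>UNIV. B i j * F j * exp (\<epsilon> * \<tau> i j) * P j)))"
  have main: "(\<Sum>i\<in>UNIV. \<theta> i * y i T) \<le> C" if T: "0 \<le> T" for T
  proof -
    define Y where "Y = (\<lambda>j. integral {0..T} (y j))"
    have Y_nonneg: "0 \<le> Y j" for j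
      unfolding Y_def using y_nonneg y_int max_delay_nonneg
      by (intro Henstock_Kurzweil_Integration.integral_nonneg) auto
    have shift_int: "(\<lambda>s. y j (s - \<tau> i j)) integrable_on {0..T}" for i j
      by (intro integrable_continuous_real continuous_on_compose2[OF y_cont] continuous_intros)
        (use delay_le_max_delay[of i j] in auto)
    have shift: "integral {0..T} (\<lambda>s. y j (s - \<tau> i j)) \<le> P j + Y j" for i j
    proof -
      have "integral {0..T} (\<lambda>s. y j (s - \<tau> i j)) = integral {- \<tau> i j..T - \<tau> i j} (y j)"
        using integral_shift[of 0 "- \<tau> i j" T "y j"] delay_le_max_delay[of i j]
          continuous_on_subset[OF y_cont, of "{- \<tau> i j..T - \<tau> i j}" j]
        by (auto simp: o_def)
      also have "\<dots> \<le> integral {-?m..T} (y j)"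
        using delay_le_max_delay[of i j] delay_nonneg[of i j] y_nonneg
        by (intro integral_subset_le y_int) auto
      also have "\<dots> = P j + Y j"
        unfolding P_def Y_def using T max_delay_nonneg y_int[of "-?m"]
        by (intro Henstock_Kurzweil_Integration.integral_combine[symmetric]) auto
      finally show ?thesis .
    qed
    have comp: "y i T - x i 0 \<le> (\<epsilon> - d0 i) * Y i + ((\<Sum>j\<in>UNIV. A i j * G j * Y j)
        + (\<Sum>j\<in>UNIV. B i j * F j * exp (\<epsilon> * \<tau> i j) * (P j + Y j)))" for i
    proof -
      let ?h = "\<lambda>t. forcing u i t - forcing v i t"
      have h_cont: "continuous_on {0..} ?h"
        by (intro continuous_intros continuous_on_forcing u_cont v_cont)
      have "y i T - x i 0 \<le> integral {0..T} (\<lambda>s. exp (\<epsilon> * s) * ((\<epsilon> - d0 i) * x i s + \<bar>?h s\<bar>))"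
        unfolding y_def x_def
      proof (rule exp_weighted_abs_le_integral[where \<delta> = "d i"])
        show "((\<lambda>s. u s $ i - v s $ i) has_real_derivative
            - d i t * (u t $ i - v t $ i) + ?h t) (at t within {0..})" if "0 \<le> t" for t
          using u v that by (intro damped_difference_deriv) (auto simp: delay_solution_def delay_rhs_eq)
      qed (use T rate_pos d0_pos[of i] d0_le h_cont in auto)
      also have "\<dots> \<le> integral {0..T} (\<lambda>s. (\<epsilon> - d0 i) * y i s + ((\<Sum>j\<in>UNIV. A i j * G j * y j s)
          + (\<Sum>j\<in>UNIV. B i j * F j * exp (\<epsilon> * \<tau> i j) * y j (s - \<tau> i j))))"
      proof (rule integral_le)
        have "continuous_on {0..T} (x i)"
          unfolding x_def using max_delay_nonneg
          by (intro continuous_intros continuous_on_subset[OF u_cont] continuous_on_subset[OF v_cont]) auto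
        then show "(\<lambda>s. exp (\<epsilon> * s) * ((\<epsilon> - d0 i) * x i s + \<bar>?h s\<bar>)) integrable_on {0..T}"
          by (intro integrable_continuous_real continuous_intros continuous_on_subset[OF h_cont]) auto
        show "(\<lambda>s. (\<epsilon> - d0 i) * y i s + ((\<Sum>j\<in>UNIV. A i j * G j * y j s)
          + (\<Sum>j\<in>UNIV. B i j * F j * exp (\<epsilon> * \<tau> i j) * y j (s - \<tau> i j)))) integrable_on {0..T}"
          using max_delay_nonneg
          by (intro integrable_add integrable_sum integrable_on_mult_right y_int shift_int) auto
        fix s assume s: "s \<in> {0..T}"
        have "exp (\<epsilon> * s) * \<bar>?h s\<bar> \<le> exp (\<epsilon> * s) * ((\<Sum>j\<in>UNIV. A i j * G j * x j s)
            + (\<Sum>j\<in>UNIV. B i j * F j * x j (s - \<tau> i j)))"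
          unfolding x_def using s by (intro mult_left_mono forcing_diff_le) auto
        also have "\<dots> = (\<Sum>j\<in>UNIV. A i j * G j * y j s)
            + (\<Sum>j\<in>UNIV. B i j * F j * exp (\<epsilon> * \<tau> i j) * y j (s - \<tau> i j))"
          unfolding y_def
          by (simp add: distrib_left sum_distrib_left mult_ac right_diff_distrib exp_diff)
        finally show "exp (\<epsilon> * s) * ((\<epsilon> - d0 i) * x i s + \<bar>?h s\<bar>)
            \<le> (\<epsilon> - d0 i) * y i s + ((\<Sum>j\<in>UNIV. A i j * G j * y j s)
            + (\<Sum>j\<in>UNIV. B i j * F j * exp (\<epsilon> * \<tau> i j) * y j (s - \<tau> i j)))"
          by (simp add: y_def algebra_simps)
      qed
      also have "\<dots> = (\<epsilon> - d0 i) * Y i + ((\<Sum>j\<in>UNIV. A i j * G j * Y j)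
          + (\<Sum>j\<in>UNIV. B i j * F j * exp (\<epsilon> * \<tau> i j) * integral {0..T} (\<lambda>s. y j (s - \<tau> i j))))"
        unfolding Y_def using max_delay_nonneg
        by (intro integral_unique has_integral_add has_integral_sum has_integral_mult_right
            integrable_integral y_int shift_int) auto
      also have "\<dots> \<le> (\<epsilon> - d0 i) * Y i + ((\<Sum>j\<in>UNIV. A i j * G j * Y j)
        + (\<Sum>j\<in>UNIV. B i j * F j * exp (\<epsilon> * \<tau> i j) * (P j + Y j)))"
        using B_nonneg F_pos
        by (intro add_left_mono sum_mono mult_left_mono shift) (auto intro!: mult_nonneg_nonneg intro: less_imp_le)
      finally show ?thesis .
    qed
    have "(\<Sum>i\<in>UNIV. \<theta> i * (y i T - x i 0)) \<le> (\<Sum>i\<in>UNIV. \<theta> i * ((\<epsilon> - d0 i) * Y i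
        + ((\<Sum>j\<in>UNIV. A i j * G j * Y j)
        + (\<Sum>j\<in>UNIV. B i j * F j * exp (\<epsilon> * \<tau> i j) * (P j + Y j)))))"
      using comp weight_pos by (intro sum_mono mult_left_mono) (auto intro: less_imp_le)
    also have "\<dots> = (\<Sum>i\<in>UNIV. \<theta> i * ((\<Sum>j\<in>UNIV. A i j * G j * Y j)
          + (\<Sum>j\<in>UNIV. B i j * F j * exp (\<epsilon> * \<tau> i j) * Y j)))
        - (\<Sum>i\<in>UNIV. (d0 i - \<epsilon>) * \<theta> i * Y i)
        + (\<Sum>i\<in>UNIV. \<theta> i * (\<Sum>j\<in>UNIV. B i j * F j * exp (\<epsilon> * \<tau> i j) * P j))"
      unfolding sum_subtractf[symmetric] sum.distrib[symmetric]
      by (rule sum.cong) (simp_all add: sum.distrib distrib_left algebra_simps)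
    also have "\<dots> \<le> (\<Sum>i\<in>UNIV. \<theta> i * (\<Sum>j\<in>UNIV. B i j * F j * exp (\<epsilon> * \<tau> i j) * P j))"
      using weighted_coupling_le[of Y] Y_nonneg by simp
    finally show ?thesis
      by (simp add: C_def right_diff_distrib distrib_left sum.distrib sum_subtractf)
  qed
  have "\<bar>u t $ i - v t $ i\<bar> \<le> (\<Sum>k\<in>UNIV. C / \<theta> k) * exp (- \<epsilon> * t)" if "0 \<le> t" for i t
  proof -
    have "\<theta> k * y k t \<le> C" for k
    proof -
      have "\<theta> k * y k t \<le> (\<Sum>i\<in>UNIV. \<theta> i * y i t)"
        using weight_pos y_nonneg by (intro member_le_sum mult_nonneg_nonneg) (auto intro: less_imp_le)
      then show ?thesis using main[OF that] by linarith
    qed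
    then have le: "y k t \<le> C / \<theta> k" for k
      using weight_pos[of k] by (simp add: field_simps)
    have "0 \<le> C / \<theta> k" for k
      using y_nonneg[of k t] le[of k] by linarith
    then have "C / \<theta> i \<le> (\<Sum>k\<in>UNIV. C / \<theta> k)"
      by (intro member_le_sum) auto
    then have "y i t \<le> (\<Sum>k\<in>UNIV. C / \<theta> k)"
      using le[of i] by linarith
    then show ?thesis
      by (simp add: y_def x_def exp_minus field_simps)
  qed
  then show ?thesis by (rule that)
qed

section \<open>The contraction and its fixed point\<close>

text \<open>The factors \<open>d0 i\<close> are chosen because a periodic solution of the linear equation is controlled by its
  forcing exactly in the form \<open>d0 i * \<integral>\<bar>w\<^sub>i\<bar> \<le> \<integral>\<bar>h\<^sub>i\<bar>\<close>.\<close>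
definition L1_dist :: "(real \<Rightarrow> real ^ 'n) \<Rightarrow> (real \<Rightarrow> real ^ 'n) \<Rightarrow> real" where
  "L1_dist \<phi> \<psi> = (\<Sum>i\<in>UNIV. \<theta> i * d0 i * integral {0..\<omega>} (\<lambda>t. \<bar>\<phi> t $ i - \<psi> t $ i\<bar>))"

text \<open>A common contraction factor: \<open>d0 j - \<epsilon> \<le> \<kappa> * d0 j\<close> is needed for all \<open>j\<close> at once, and the sum of the
  \<open>d0 i\<close> serves as an upper bound for their maximum.\<close>
definition \<kappa> :: real where
  "\<kappa> = 1 - \<epsilon> / (\<Sum>i\<in>UNIV. d0 i)"

lemma rate_le_d0: "\<epsilon> \<le> d0 j"
proof -
  have "0 \<le> G j * (\<Sum>i\<in>UNIV. \<theta> i * A i j) + F j * (\<Sum>i\<in>UNIV. \<theta> i * B i j * exp (\<epsilon> * \<tau> i j))"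
    using G_pos F_pos weight_pos A_nonneg B_nonneg
    by (intro add_nonneg_nonneg mult_nonneg_nonneg sum_nonneg) (auto intro: less_imp_le)
  then have "(\<epsilon> - d0 j) * \<theta> j \<le> 0"
    using dominance[of j] by (simp add: algebra_simps)
  then show ?thesis
    using weight_pos[of j] by (simp add: mult_le_0_iff)
qed

lemma d0_le_sum: "d0 j \<le> (\<Sum>i\<in>UNIV. d0 i)"
  using d0_pos by (intro member_le_sum) (auto intro: less_imp_le)

lemma \<kappa>_nonneg: "0 \<le> \<kappa>" and \<kappa>_less_1: "\<kappa> < 1"
  and rate_le_\<kappa>: "d0 j - \<epsilon> \<le> \<kappa> * d0 j"
proof -
  let ?D = "\<Sum>i\<in>UNIV. d0 i"
  have D: "0 < ?D" using d0_pos d0_le_sum by (metis less_le_trans)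
  then show "0 \<le> \<kappa>" "\<kappa> < 1"
    using order_trans[OF rate_le_d0 d0_le_sum] rate_pos by (simp_all add: \<kappa>_def)
  have "\<epsilon> * d0 j \<le> \<epsilon> * ?D"
    using d0_le_sum rate_pos by simp
  then have "\<epsilon> * d0 j / ?D \<le> \<epsilon>"
    using D by (simp add: field_simps)
  then show "d0 j - \<epsilon> \<le> \<kappa> * d0 j"
    by (simp add: \<kappa>_def algebra_simps)
qed

text \<open>For periodic functions a delay does not change the integral over a period, so the delayed
  and the undelayed coupling contribute alike. The factors \<open>exp (\<epsilon> * \<tau> i j) \<ge> 1\<close> are inserted
  to apply the dominance hypothesis in the form it has.\<close>
lemma forcing_L1_le:
  assumes \<phi>: "continuous_on UNIV \<phi>" "\<And>t. \<phi> (t + \<omega>) = \<phi> t"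
    and \<phi>': "continuous_on UNIV \<phi>'" "\<And>t. \<phi>' (t + \<omega>) = \<phi>' t"
  shows "(\<Sum>i\<in>UNIV. \<theta> i * integral {0..\<omega>} (\<lambda>t. \<bar>forcing \<phi> i t - forcing \<phi>' i t\<bar>)) \<le> \<kappa> * L1_dist \<phi> \<phi>'"
proof -
  define x where "x = (\<lambda>j t. \<bar>\<phi> t $ j - \<phi>' t $ j\<bar>)"
  define X where "X = (\<lambda>j. integral {0..\<omega>} (x j))"
  have x_cont: "continuous_on UNIV (x j)" for j
    unfolding x_def by (intro continuous_intros \<phi>(1) \<phi>'(1))
  have x_per: "x j (t + \<omega>) = x j t" for j t
    by (simp add: x_def \<phi>(2) \<phi>'(2))
  have x_int: "(\<lambda>t. x j (t - s)) integrable_on {0..\<omega>}" for j s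
    by (intro integrable_continuous_real continuous_on_compose2[OF x_cont] continuous_intros) auto
  have x_int0: "x j integrable_on {0..\<omega>}" for j
    using x_int[of j 0] by simp
  have X_nonneg: "0 \<le> X j" for j
    unfolding X_def by (intro Henstock_Kurzweil_Integration.integral_nonneg x_int0) (auto simp: x_def)
  have shift: "integral {0..\<omega>} (\<lambda>t. x j (t - \<tau> i j)) = X j" for i j
    unfolding X_def using period_pos delay_nonneg x_cont x_per by (intro periodic_integral_shift) auto
  have one: "integral {0..\<omega>} (\<lambda>t. \<bar>forcing \<phi> i t - forcing \<phi>' i t\<bar>)
      \<le> (\<Sum>j\<in>UNIV. A i j * G j * X j) + (\<Sum>j\<in>UNIV. B i j * F j * exp (\<epsilon> * \<tau> i j) * X j)" for i
  proof -
    have "integral {0..\<omega>} (\<lambda>t. \<bar>forcing \<phi> i t - forcing \<phi>' i t\<bar>)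
      \<le> integral {0..\<omega>} (\<lambda>t. (\<Sum>j\<in>UNIV. A i j * G j * x j t)
          + (\<Sum>j\<in>UNIV. B i j * F j * x j (t - \<tau> i j)))"
    proof (rule integral_le)
      have "continuous_on {0..\<omega>} (forcing \<phi> i)" "continuous_on {0..\<omega>} (forcing \<phi>' i)"
        using continuous_on_forcing[THEN continuous_on_subset] continuous_on_subset[OF \<phi>(1)]
          continuous_on_subset[OF \<phi>'(1)] by auto
      then show "(\<lambda>t. \<bar>forcing \<phi> i t - forcing \<phi>' i t\<bar>) integrable_on {0..\<omega>}"
        by (intro integrable_continuous_real continuous_intros)
      show "(\<lambda>t. (\<Sum>j\<in>UNIV. A i j * G j * x j t)
          + (\<Sum>j\<in>UNIV. B i j * F j * x j (t - \<tau> i j))) integrable_on {0..\<omega>}"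
        by (intro integrable_add integrable_sum integrable_on_mult_right x_int x_int0) auto
    qed (auto simp: x_def intro: forcing_diff_le)
    also have "\<dots> = (\<Sum>j\<in>UNIV. A i j * G j * X j)
        + (\<Sum>j\<in>UNIV. B i j * F j * integral {0..\<omega>} (\<lambda>t. x j (t - \<tau> i j)))"
      unfolding X_def
      by (intro integral_unique has_integral_add has_integral_sum has_integral_mult_right
          integrable_integral x_int x_int0) auto
    also have "\<dots> = (\<Sum>j\<in>UNIV. A i j * G j * X j) + (\<Sum>j\<in>UNIV. B i j * F j * 1 * X j)"
      by (simp add: shift)
    also have "\<dots> \<le> (\<Sum>j\<in>UNIV. A i j * G j * X j) + (\<Sum>j\<in>UNIV. B i j * F j * exp (\<epsilon> * \<tau> i j) * X j)"
      using B_nonneg F_pos X_nonneg rate_pos delay_nonneg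
      by (intro add_left_mono sum_mono mult_right_mono mult_left_mono)
        (auto intro!: mult_nonneg_nonneg intro: less_imp_le)
    finally show ?thesis .
  qed
  have "(\<Sum>i\<in>UNIV. \<theta> i * integral {0..\<omega>} (\<lambda>t. \<bar>forcing \<phi> i t - forcing \<phi>' i t\<bar>))
    \<le> (\<Sum>i\<in>UNIV. \<theta> i * ((\<Sum>j\<in>UNIV. A i j * G j * X j)
      + (\<Sum>j\<in>UNIV. B i j * F j * exp (\<epsilon> * \<tau> i j) * X j)))"
    using one weight_pos by (intro sum_mono mult_left_mono) (auto intro: less_imp_le)
  also have "\<dots> \<le> (\<Sum>j\<in>UNIV. (d0 j - \<epsilon>) * \<theta> j * X j)"
    using X_nonneg by (rule weighted_coupling_le)
  also have "\<dots> \<le> (\<Sum>j\<in>UNIV. \<kappa> * d0 j * \<theta> j * X j)"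
    using rate_le_\<kappa> weight_pos X_nonneg
    by (intro sum_mono mult_right_mono) (auto intro: less_imp_le)
  also have "\<dots> = \<kappa> * L1_dist \<phi> \<phi>'"
    unfolding L1_dist_def X_def x_def by (simp add: sum_distrib_left mult_ac)
  finally show ?thesis .
qed

text \<open>The difference of two responses is a periodic solution of the scalar equations with the difference
  of the forcings. Contraction alone would give a limit in \<open>L\<^sup>1\<close>; the supremum bound makes the
  limit continuous.\<close>
lemma
  assumes \<phi>: "continuous_on UNIV \<phi>" "\<And>t. \<phi> (t + \<omega>) = \<phi> t"
    and \<phi>': "continuous_on UNIV \<phi>'" "\<And>t. \<phi>' (t + \<omega>) = \<phi>' t"
    and \<psi>: "periodic_response \<phi> \<psi>" "periodic_response \<phi>' \<psi>'"
  shows periodic_response_L1_contraction: "L1_dist \<psi> \<psi>' \<le> \<kappa> * L1_dist \<phi> \<phi>'"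
    and periodic_response_sup_le: "\<bar>\<psi> t $ i - \<psi>' t $ i\<bar>
      \<le> (\<Sum>k\<in>UNIV. exp (d0 k * \<omega>) * (1 + 1 / (exp (d0 k * \<omega>) - 1)) / \<theta> k) * L1_dist \<phi> \<phi>'"
proof -
  let ?h = "\<lambda>i t. forcing \<phi> i t - forcing \<phi>' i t"
  let ?w = "\<lambda>i t. \<psi> t $ i - \<psi>' t $ i"
  let ?N = "\<lambda>i. integral {0..\<omega>} (\<lambda>t. \<bar>?h i t\<bar>)"
  have h_cont: "continuous_on {0..} (?h i)" for i
    using continuous_on_forcing continuous_on_subset[OF \<phi>(1)] continuous_on_subset[OF \<phi>'(1)]
    by (intro continuous_intros) auto
  have w_deriv: "(?w i has_real_derivative (- d i t * ?w i t + ?h i t)) (at t within {0..})"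
    if "0 \<le> t" for i t
    using \<psi> that by (intro damped_difference_deriv) (auto simp: periodic_response_def)
  have w_per: "?w i (t + \<omega>) = ?w i t" for i t
    using \<psi> by (simp add: periodic_response_def)
  have "L1_dist \<psi> \<psi>' = (\<Sum>i\<in>UNIV. \<theta> i * (d0 i * integral {0..\<omega>} (\<lambda>t. \<bar>?w i t\<bar>)))"
    by (simp add: L1_dist_def mult.assoc)
  also have "\<dots> \<le> (\<Sum>i\<in>UNIV. \<theta> i * ?N i)"
    using weight_pos
    by (intro sum_mono mult_left_mono 
        periodic_solution_L1_le[OF period_pos d0_pos h_cont d0_le w_deriv w_per])
      (auto intro: less_imp_le)
  also have N_sum: "\<dots> \<le> \<kappa> * L1_dist \<phi> \<phi>'"
    using \<phi> \<phi>' by (rule forcing_L1_le)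
  finally show "L1_dist \<psi> \<psi>' \<le> \<kappa> * L1_dist \<phi> \<phi>'" .
  have dist_nonneg: "0 \<le> L1_dist \<phi> \<phi>'"
  proof -
    have "continuous_on {0..\<omega>} \<phi>" "continuous_on {0..\<omega>} \<phi>'"
      using \<phi>(1) \<phi>'(1) by (auto intro: continuous_on_subset)
    then show ?thesis
      unfolding L1_dist_def using weight_pos d0_pos
      by (intro sum_nonneg mult_nonneg_nonneg Henstock_Kurzweil_Integration.integral_nonneg
          integrable_continuous_real continuous_intros) (auto intro: less_imp_le)
  qed
  have N_nonneg: "0 \<le> ?N k" for k
    by (intro Henstock_Kurzweil_Integration.integral_nonneg integrable_continuous_real
        continuous_intros continuous_on_subset[OF h_cont]) auto
  have "\<kappa> * L1_dist \<phi> \<phi>' \<le> L1_dist \<phi> \<phi>'"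
    using mult_right_mono[OF less_imp_le[OF \<kappa>_less_1] dist_nonneg] by simp
  note N_dist = order_trans[OF N_sum this]
  have "\<theta> k * ?N k \<le> (\<Sum>i\<in>UNIV. \<theta> i * ?N i)" for k
    using weight_pos N_nonneg by (intro member_le_sum mult_nonneg_nonneg) (auto intro: less_imp_le)
  then have "\<theta> k * ?N k \<le> L1_dist \<phi> \<phi>'" for k
    using N_dist by (rule order_trans)
  then have N_le: "?N k \<le> L1_dist \<phi> \<phi>' / \<theta> k" for k
    using weight_pos[of k] by (simp add: field_simps)
  define K where "K = (\<lambda>k. exp (d0 k * \<omega>) * (1 + 1 / (exp (d0 k * \<omega>) - 1)))"
  have K_nonneg: "0 \<le> K k" for k
    using d0_pos[of k] period_pos by (simp add: K_def)
  have "\<bar>?w i t\<bar> \<le> K i * ?N i"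
    unfolding K_def
    by (rule periodic_solution_sup_le[where w = "?w i", OF period_pos d0_pos h_cont d0_le w_deriv w_per])
  also have "\<dots> \<le> K i * (L1_dist \<phi> \<phi>' / \<theta> i)"
    using N_le K_nonneg by (rule mult_left_mono)
  also have "\<dots> = K i / \<theta> i * L1_dist \<phi> \<phi>'"
    by simp
  also have "\<dots> \<le> (\<Sum>k\<in>UNIV. K k / \<theta> k) * L1_dist \<phi> \<phi>'"
    using K_nonneg weight_pos
    by (intro mult_right_mono member_le_sum dist_nonneg divide_nonneg_nonneg) (auto intro: less_imp_le)
  finally show "\<bar>\<psi> t $ i - \<psi>' t $ i\<bar>
      \<le> (\<Sum>k\<in>UNIV. exp (d0 k * \<omega>) * (1 + 1 / (exp (d0 k * \<omega>) - 1)) / \<theta> k) * L1_dist \<phi> \<phi>'"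
    unfolding K_def .
qed

lemma L1_dist_le_uniform:
  assumes "continuous_on UNIV \<phi>" "continuous_on UNIV \<psi>" "\<And>t. dist (\<phi> t) (\<psi> t) \<le> e"
  shows "L1_dist \<phi> \<psi> \<le> (\<Sum>i\<in>UNIV. \<theta> i * d0 i * \<omega>) * e"
proof -
  have "integral {0..\<omega>} (\<lambda>t. \<bar>\<phi> t $ i - \<psi> t $ i\<bar>) \<le> \<omega> * e" for i
  proof -
    have cont: "continuous_on {0..\<omega>} \<phi>" "continuous_on {0..\<omega>} \<psi>"
      using assms(1,2) by (auto intro: continuous_on_subset)
    have "integral {0..\<omega>} (\<lambda>t. \<bar>\<phi> t $ i - \<psi> t $ i\<bar>) \<le> integral {0..\<omega>} (\<lambda>t. e)"
    proof (rule integral_le)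
      show "(\<lambda>t. \<bar>\<phi> t $ i - \<psi> t $ i\<bar>) integrable_on {0..\<omega>}"
        by (intro integrable_continuous_real continuous_intros cont)
      show "\<bar>\<phi> t $ i - \<psi> t $ i\<bar> \<le> e" for t
        using component_le_norm_cart[of "\<phi> t - \<psi> t" i] assms(3)[of t] by (simp add: dist_norm)
    qed auto
    then show ?thesis using period_pos by simp
  qed
  then have "L1_dist \<phi> \<psi> \<le> (\<Sum>i\<in>UNIV. \<theta> i * d0 i * (\<omega> * e))"
    unfolding L1_dist_def using weight_pos d0_pos
    by (intro sum_mono mult_left_mono) (auto intro!: mult_nonneg_nonneg intro: less_imp_le)
  then show ?thesis by (simp add: sum_distrib_right mult.assoc)
qed

text \<open>The uniform limit \<open>v\<close> of the Picard iterates is identified as a fixed point without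
  passing to the limit in the derivatives: the image of \<open>v\<close> is a response by construction, and
  by the supremum bound it is close to the next iterate whenever \<open>v\<close> is close to the current one.\<close>
lemma periodic_solution_exists: "\<exists>v. periodic_delay_solution \<omega> d a b I \<tau> g f v"
proof -
  define admissible where
    "admissible = (\<lambda>\<phi> :: real \<Rightarrow> real ^ 'n. continuous_on UNIV \<phi> \<and> (\<forall>t. \<phi> (t + \<omega>) = \<phi> t))"
  have "\<forall>\<phi>. \<exists>\<psi>. admissible \<phi> \<longrightarrow> periodic_response \<phi> \<psi>"
    using periodic_response_exists unfolding admissible_def by blast
  then obtain T where T: "\<And>\<phi>. admissible \<phi> \<Longrightarrow> periodic_response \<phi> (T \<phi>)"
    by metis
  have T_adm: "admissible (T \<phi>)" if "admissible \<phi>" for \<phi>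
    using T[OF that] by (simp add: admissible_def periodic_response_def)
  define K where "K = (\<Sum>k\<in>UNIV. exp (d0 k * \<omega>) * (1 + 1 / (exp (d0 k * \<omega>) - 1)) / \<theta> k)"
  have contr: "L1_dist (T \<phi>) (T \<psi>) \<le> \<kappa> * L1_dist \<phi> \<psi>"
    and sup: "\<bar>T \<phi> t $ i - T \<psi> t $ i\<bar> \<le> K * L1_dist \<phi> \<psi>"
    if "admissible \<phi>" "admissible \<psi>" for \<phi> \<psi> t i
    using that periodic_response_L1_contraction[of \<phi> \<psi> "T \<phi>" "T \<psi>"]
      periodic_response_sup_le[of \<phi> \<psi> "T \<phi>" "T \<psi>"] T[of \<phi>] T[of \<psi>]
    by (auto simp: K_def admissible_def)
  have K_nonneg: "0 \<le> K"
    unfolding K_def using weight_pos d0_pos period_pos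
    by (intro sum_nonneg divide_nonneg_nonneg mult_nonneg_nonneg add_nonneg_nonneg) (auto intro: less_imp_le)
  define \<phi> where "\<phi> = (\<lambda>k. (T ^^ k) (\<lambda>_. 0))"
  have \<phi>_Suc: "\<phi> (Suc k) = T (\<phi> k)" for k by (simp add: \<phi>_def)
  have adm: "admissible (\<phi> k)" for k
  proof (induction k)
    case 0
    show ?case by (simp add: \<phi>_def admissible_def)
  next
    case (Suc k)
    then show ?case unfolding \<phi>_Suc by (rule T_adm)
  qed
  define E where "E = L1_dist (\<phi> (Suc 0)) (\<phi> 0)"
  have geometric: "L1_dist (\<phi> (Suc k)) (\<phi> k) \<le> \<kappa> ^ k * E" for k
  proof (induction k)
    case (Suc k)
    have "L1_dist (\<phi> (Suc (Suc k))) (\<phi> (Suc k)) \<le> \<kappa> * L1_dist (\<phi> (Suc k)) (\<phi> k)"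
      using contr[OF adm adm, of "Suc k" k] by (simp add: \<phi>_Suc)
    also have "\<dots> \<le> \<kappa> * (\<kappa> ^ k * E)"
      using Suc \<kappa>_nonneg by (rule mult_left_mono)
    finally show ?case by (simp add: mult.assoc)
  qed (simp add: E_def)
  (* The supremum bound applies to images only, so the telescoping series starts at the first image. *)
  let ?step = "\<lambda>k t. \<phi> (Suc (Suc k)) t - \<phi> (Suc k) t"
  have step_le: "norm (?step k t) \<le> real CARD('n) * K * E * \<kappa> ^ k" for k t
  proof -
    have "norm (?step k t) \<le> (\<Sum>i\<in>UNIV. \<bar>?step k t $ i\<bar>)"
      by (rule norm_le_l1_cart)
    also have "\<dots> \<le> (\<Sum>i\<in>(UNIV :: 'n set). K * (\<kappa> ^ k * E))"
    proof (rule sum_mono)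
      fix i
      have "\<bar>?step k t $ i\<bar> \<le> K * L1_dist (\<phi> (Suc k)) (\<phi> k)"
        using sup[OF adm adm, of "Suc k" t i k] by (simp add: \<phi>_Suc)
      also have "\<dots> \<le> K * (\<kappa> ^ k * E)"
        using geometric K_nonneg by (rule mult_left_mono)
      finally show "\<bar>?step k t $ i\<bar> \<le> K * (\<kappa> ^ k * E)" .
    qed
    finally show ?thesis by (simp add: mult_ac)
  qed
  have majorant: "summable (\<lambda>k. real CARD('n) * K * E * \<kappa> ^ k)"
    using \<kappa>_nonneg \<kappa>_less_1 by (intro summable_mult summable_geometric) auto
  have "uniform_limit UNIV (\<lambda>n t. \<Sum>k<n. ?step k t) (\<lambda>t. \<Sum>k. ?step k t) sequentially"
    by (rule Weierstrass_m_test[OF step_le majorant])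
  moreover have "(\<Sum>k<n. ?step k t) = \<phi> (Suc n) t - \<phi> (Suc 0) t" for n t
    using sum_lessThan_telescope[of "\<lambda>k. \<phi> (Suc k) t" n] by simp
  ultimately have lim: "uniform_limit UNIV (\<lambda>n t. \<phi> (Suc n) t - \<phi> (Suc 0) t) (\<lambda>t. \<Sum>k. ?step k t) sequentially"
    by simp
  define v where "v = (\<lambda>t. (\<Sum>k. ?step k t) + \<phi> (Suc 0) t)"
  have "uniform_limit UNIV (\<lambda>n t. (\<phi> (Suc n) t - \<phi> (Suc 0) t) + \<phi> (Suc 0) t) v sequentially"
    unfolding v_def by (intro uniform_limit_add lim uniform_limit_const)
  then have v_lim: "uniform_limit UNIV (\<lambda>n. \<phi> (Suc n)) v sequentially"
    by simp
  have "continuous_on UNIV v"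
    using adm by (intro uniform_limit_theorem[OF _ v_lim]) (auto simp: admissible_def)
  moreover have "v (t + \<omega>) = v t" for t
  proof (rule LIMSEQ_unique)
    show "(\<lambda>n. \<phi> (Suc n) t) \<longlonglongrightarrow> v t"
      by (rule tendsto_uniform_limitI[OF v_lim]) simp
    have "(\<lambda>n. \<phi> (Suc n) (t + \<omega>)) \<longlonglongrightarrow> v (t + \<omega>)"
      by (rule tendsto_uniform_limitI[OF v_lim]) simp
    then show "(\<lambda>n. \<phi> (Suc n) t) \<longlonglongrightarrow> v (t + \<omega>)"
      using adm by (simp add: admissible_def)
  qed
  ultimately have v_adm: "admissible v"
    by (simp add: admissible_def)
  (* S collects two errors: that of the image of v against the next iterate (K times an L1-distance)
     and that of the next iterate against v itself (the summand 1). *)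
  define S where "S = K * (\<Sum>i\<in>UNIV. \<theta> i * d0 i * \<omega>) + 1"
  have "0 \<le> (\<Sum>i\<in>UNIV. \<theta> i * d0 i * \<omega>)"
    using weight_pos d0_pos period_pos by (intro sum_nonneg mult_nonneg_nonneg) (auto intro: less_imp_le)
  then have S_pos: "0 < S"
    using K_nonneg by (simp add: S_def add_nonneg_pos)
  have "T v t $ i = v t $ i" for t i
  proof -
    have "\<bar>T v t $ i - v t $ i\<bar> \<le> 0 + e" if "e > 0" for e
    proof -
      from S_pos that have "e / S > 0" by simp
      then have "\<forall>\<^sub>F n in sequentially. \<forall>t\<in>UNIV. dist (\<phi> (Suc n) t) (v t) < e / S"
        using v_lim by (simp add: uniform_limit_iff)
      then obtain N where N: "\<And>n t. n \<ge> N \<Longrightarrow> dist (\<phi> (Suc n) t) (v t) < e / S"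
        by (auto simp: eventually_sequentially)
      have "L1_dist v (\<phi> (Suc N)) \<le> (\<Sum>i\<in>UNIV. \<theta> i * d0 i * \<omega>) * (e / S)"
        using v_adm adm[of "Suc N"] N[of N]
        by (intro L1_dist_le_uniform) (auto simp: admissible_def dist_commute intro: less_imp_le)
      then have "K * L1_dist v (\<phi> (Suc N)) \<le> K * ((\<Sum>i\<in>UNIV. \<theta> i * d0 i * \<omega>) * (e / S))"
        using K_nonneg by (rule mult_left_mono)
      then have "\<bar>T v t $ i - \<phi> (Suc (Suc N)) t $ i\<bar> \<le> (S - 1) * (e / S)"
        using sup[OF v_adm adm, of t i "Suc N"] by (simp add: \<phi>_Suc S_def)
      moreover have "\<bar>\<phi> (Suc (Suc N)) t $ i - v t $ i\<bar> \<le> e / S"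
        using component_le_norm_cart[of "\<phi> (Suc (Suc N)) t - v t" i] N[of "Suc N" t]
        by (simp add: dist_norm)
      moreover have "(S - 1) * (e / S) + e / S = e"
        using S_pos by (simp add: field_simps)
      ultimately show ?thesis by linarith
    qed
    then have "\<bar>T v t $ i - v t $ i\<bar> \<le> 0"
      by (rule field_le_epsilon)
    then show ?thesis by simp
  qed
  then have "T v = v"
    by (simp add: fun_eq_iff vec_eq_iff)
  then show ?thesis
    using T[OF v_adm] periodic_response_self_imp_solution by auto
qed

text \<open>Only those \<open>j\<close> matter for which \<open>t + j * \<omega> \<ge> 0\<close>; for them the exponential bound on
  \<open>[0,\<infinity>)\<close> applies, and \<open>v (t + j * \<omega>) = v t\<close>.\<close>
lemma solution_approaches_periodic_solution:
  assumes u: "delay_solution d a b I \<tau> g f u"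
    and v: "periodic_delay_solution \<omega> d a b I \<tau> g f v"
    and t: "- max_delay \<tau> \<le> t"
  shows "(\<lambda>j. \<bar>u (t + real j * \<omega>) $ i - v t $ i\<bar>) \<in> O(\<lambda>j. exp (- (real j * \<epsilon> * \<omega>)))"
proof -
  have v_sol: "delay_solution d a b I \<tau> g f v"
    using v by (simp add: periodic_delay_solution_def)
  obtain C where C: "\<And>i t. 0 \<le> t \<Longrightarrow> \<bar>u t $ i - v t $ i\<bar> \<le> C * exp (- \<epsilon> * t)"
    using solutions_approach_exponentially[OF u v_sol] by blast
  obtain n :: nat where n: "- t / \<omega> < real n"
    using reals_Archimedean2 by blast
  show ?thesis
  proof (rule bigoI[where c = "C * exp (- \<epsilon> * t)"])
    show "\<forall>\<^sub>F j in sequentially. norm \<bar>u (t + real j * \<omega>) $ i - v t $ i\<bar>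
        \<le> C * exp (- \<epsilon> * t) * norm (exp (- (real j * \<epsilon> * \<omega>)))"
      using eventually_ge_at_top[of n]
    proof eventually_elim
      case (elim j)
      then have "- t / \<omega> < real j" using n by linarith
      then have "0 \<le> t + real j * \<omega>"
        using period_pos by (simp add: field_simps)
      moreover have "v (t + real j * \<omega>) = v t"
        using v t period_pos periodic_plus_nat[of \<omega> "- max_delay \<tau>" t v j]
        by (auto simp: periodic_delay_solution_def)
      ultimately have "\<bar>u (t + real j * \<omega>) $ i - v t $ i\<bar> \<le> C * exp (- \<epsilon> * (t + real j * \<omega>))"
        using C[of "t + real j * \<omega>" i] by simp
      also have "exp (- \<epsilon> * (t + real j * \<omega>)) = exp (- \<epsilon> * t) * exp (- (real j * \<epsilon> * \<omega>))"
        by (simp add: exp_add[symmetric] algebra_simps)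
      finally show ?case by simp
    qed
  qed
qed

text \<open>Uniqueness is a consequence of stability: a second periodic solution approaches the first along \<open>t + j * \<omega>\<close>,
  while their difference at these points does not depend on \<open>j\<close>.\<close>
lemma unique_periodic_solution_exists:
  "\<exists>v. unique_periodic_delay_solution \<omega> d a b I \<tau> g f v \<and>
     (\<forall>u. delay_solution d a b I \<tau> g f u \<longrightarrow>
       (\<forall>i. \<forall>t\<ge>- max_delay \<tau>.
         (\<lambda>j. \<bar>u (t + real j * \<omega>) $ i - v t $ i\<bar>) \<in> O(\<lambda>j. exp (- (real j * \<epsilon> * \<omega>)))))"
proof -
  obtain v where v: "periodic_delay_solution \<omega> d a b I \<tau> g f v"
    using periodic_solution_exists by blast
  have "w t = v t" if w: "periodic_delay_solution \<omega> d a b I \<tau> g f w" and t: "- max_delay \<tau> \<le> t" for w t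
  proof -
    have "w t $ i = v t $ i" for i
    proof -
      have w_per: "w (t + real j * \<omega>) = w t" for j
        using w t period_pos periodic_plus_nat[of \<omega> "- max_delay \<tau>" t w j]
        by (auto simp: periodic_delay_solution_def)
      have "(\<lambda>j. \<bar>w (t + real j * \<omega>) $ i - v t $ i\<bar>) \<in> O(\<lambda>j. exp (- (real j * \<epsilon> * \<omega>)))"
        using w v t by (intro solution_approaches_periodic_solution) (auto simp: periodic_delay_solution_def)
      moreover have "(\<lambda>j. exp (- (real j * \<epsilon> * \<omega>))) \<in> o(\<lambda>_. 1)"
      proof -
        have "exp (- (real j * \<epsilon> * \<omega>)) = exp (- (\<epsilon> * \<omega>)) ^ j" for j
          by (simp add: exp_of_nat_mult[symmetric] mult.assoc)
        moreover have "(\<lambda>j. exp (- (\<epsilon> * \<omega>)) ^ j) \<longlonglongrightarrow> 0"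
          using rate_pos period_pos by (intro LIMSEQ_power_zero) auto
        ultimately show ?thesis by (intro smalloI_tendsto) auto
      qed
      ultimately have "(\<lambda>j. \<bar>w (t + real j * \<omega>) $ i - v t $ i\<bar>) \<in> o(\<lambda>_. 1)"
        by (rule landau_o.big_small_trans)
      then have "(\<lambda>j. \<bar>w (t + real j * \<omega>) $ i - v t $ i\<bar>) \<longlonglongrightarrow> 0"
        using smalloD_tendsto by fastforce
      then show ?thesis
        by (simp add: w_per LIMSEQ_const_iff)
    qed
    then show ?thesis by (simp add: vec_eq_iff)
  qed
  then have "unique_periodic_delay_solution \<omega> d a b I \<tau> g f v"
    using v by (auto simp: unique_periodic_delay_solution_def)
  then show ?thesis
    using v solution_approaches_periodic_solution by blast
qed

end

section \<open>The theorem\<close>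

lemma strict_dominance_imp_rate:
  fixes d0 \<theta> p F :: "'n::finite \<Rightarrow> real" and q \<tau> :: "'n \<Rightarrow> 'n \<Rightarrow> real"
  assumes "\<And>i. - d0 i * \<theta> i + p i + F i * (\<Sum>j\<in>UNIV. q i j) < 0"
  shows "\<exists>\<epsilon>>0. \<forall>i. (- d0 i + \<epsilon>) * \<theta> i + p i + F i * (\<Sum>j\<in>UNIV. q i j * exp (\<epsilon> * \<tau> j i)) \<le> 0"
proof -
  have "\<forall>\<^sub>F \<epsilon> in at_right 0.
      (- d0 i + \<epsilon>) * \<theta> i + p i + F i * (\<Sum>j\<in>UNIV. q i j * exp (\<epsilon> * \<tau> j i)) < 0" for i
  proof (rule order_tendstoD(2))
    show "((\<lambda>\<epsilon>. (- d0 i + \<epsilon>) * \<theta> i + p i + F i * (\<Sum>j\<in>UNIV. q i j * exp (\<epsilon> * \<tau> j i)))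
        \<longlongrightarrow> (- d0 i + 0) * \<theta> i + p i + F i * (\<Sum>j\<in>UNIV. q i j * exp (0 * \<tau> j i))) (at_right 0)"
      by (intro tendsto_intros)
  qed (use assms[of i] in simp)
  then have "\<forall>\<^sub>F \<epsilon> in at_right 0. \<forall>i.
      (- d0 i + \<epsilon>) * \<theta> i + p i + F i * (\<Sum>j\<in>UNIV. q i j * exp (\<epsilon> * \<tau> j i)) < 0"
    by (rule eventually_all_finite)
  with eventually_at_right_less[of "0 :: real"] have "\<forall>\<^sub>F \<epsilon> in at_right 0. \<epsilon> > 0 \<and> (\<forall>i.
      (- d0 i + \<epsilon>) * \<theta> i + p i + F i * (\<Sum>j\<in>UNIV. q i j * exp (\<epsilon> * \<tau> j i)) < 0)"
    by eventually_elim auto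
  then obtain \<epsilon> where "\<epsilon> > 0" "\<And>i.
      (- d0 i + \<epsilon>) * \<theta> i + p i + F i * (\<Sum>j\<in>UNIV. q i j * exp (\<epsilon> * \<tau> j i)) < 0"
    using eventually_happens[of _ "at_right (0 :: real)"] by auto
  then show ?thesis by (auto intro: less_imp_le)
qed

theorem theorem2:
  fixes \<omega> :: real
    and d :: "'n::finite \<Rightarrow> real \<Rightarrow> real"
    and d0 :: "'n \<Rightarrow> real"
    and a b :: "'n \<Rightarrow> 'n \<Rightarrow> real \<Rightarrow> real"
    and I :: "'n \<Rightarrow> real \<Rightarrow> real"
    and \<tau> :: "'n \<Rightarrow> 'n \<Rightarrow> real"
    and g f :: "'n \<Rightarrow> real \<Rightarrow> real"
    and G F :: "'n \<Rightarrow> real"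
  assumes "\<omega> > 0"
    and "\<And>i j. \<tau> i j \<ge> 0"
    and "\<And>i. continuous_periodic \<omega> (d i)"
    and "\<And>i j. continuous_periodic \<omega> (a i j)"
    and "\<And>i j. continuous_periodic \<omega> (b i j)"
    and "\<And>i. continuous_periodic \<omega> (I i)"
    and "\<And>i. d0 i > 0"
    and "\<And>i t. t \<ge> 0 \<Longrightarrow> d i t \<ge> d0 i"
    and "\<And>i. G i > 0"
    and "\<And>i. F i > 0"
    and "g \<in> class_H G"
    and "f \<in> class_H F"
  shows
    "(\<forall>\<epsilon> \<theta>. \<epsilon> > 0 \<and> (\<forall>i. \<theta> i > 0) \<and>
        (\<forall>i. (- d0 i + \<epsilon>) * \<theta> i
           + G i * (\<theta> i * period_sup \<omega> (a i i) + (\<Sum>j\<in>UNIV - {i}. \<theta> j * period_sup \<omega> (a j i)))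
           + F i * (\<Sum>j\<in>UNIV. \<theta> j * period_sup \<omega> (b j i) * exp (\<epsilon> * \<tau> j i)) \<le> 0)
      \<longrightarrow> (\<exists>v. unique_periodic_delay_solution \<omega> d a b I \<tau> g f v \<and>
             (\<forall>u. delay_solution d a b I \<tau> g f u \<longrightarrow>
               (\<forall>i. \<forall>t\<ge>- max_delay \<tau>.
                 (\<lambda>j. \<bar>u (t + real j * \<omega>) $ i - v t $ i\<bar>) \<in> O(\<lambda>j. exp (- (real j * \<epsilon> * \<omega>)))))))
     \<and>
     (\<forall>\<theta>. (\<forall>i. \<theta> i > 0) \<and>
        (\<forall>i. - d0 i * \<theta> i
           + G i * (\<theta> i * period_sup \<omega> (a i i) + (\<Sum>j\<in>UNIV - {i}. \<theta> j * period_sup \<omega> (a j i)))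
           + F i * (\<Sum>j\<in>UNIV. \<theta> j * period_sup \<omega> (b j i)) < 0)
      \<longrightarrow> (\<exists>v. unique_periodic_delay_solution \<omega> d a b I \<tau> g f v \<and>
             (\<exists>\<epsilon>>0. \<forall>u. delay_solution d a b I \<tau> g f u \<longrightarrow>
               (\<forall>i. \<forall>t\<ge>- max_delay \<tau>.
                 (\<lambda>j. \<bar>u (t + real j * \<omega>) $ i - v t $ i\<bar>) \<in> O(\<lambda>j. exp (- (real j * \<epsilon> * \<omega>)))))))"
proof -
  let ?lhs = "\<lambda>\<theta> \<epsilon> i. (- d0 i + \<epsilon>) * \<theta> i
    + G i * (\<theta> i * period_sup \<omega> (a i i) + (\<Sum>j\<in>UNIV - {i}. \<theta> j * period_sup \<omega> (a j i)))
    + F i * (\<Sum>j\<in>UNIV. \<theta> j * period_sup \<omega> (b j i) * exp (\<epsilon> * \<tau> j i))"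
  interpret periodic_delay_system \<omega> d d0 a b I \<tau> g f G F
    by unfold_locales (use assms in auto)
  have part1: "\<exists>v. unique_periodic_delay_solution \<omega> d a b I \<tau> g f v \<and>
      (\<forall>u. delay_solution d a b I \<tau> g f u \<longrightarrow>
        (\<forall>i. \<forall>t\<ge>- max_delay \<tau>.
          (\<lambda>j. \<bar>u (t + real j * \<omega>) $ i - v t $ i\<bar>) \<in> O(\<lambda>j. exp (- (real j * \<epsilon> * \<omega>)))))"
    if "\<epsilon> > 0" "\<And>i. \<theta> i > 0" "\<And>i. ?lhs \<theta> \<epsilon> i \<le> 0" for \<epsilon> \<theta>
  proof -
    have "dominated_delay_system \<omega> d d0 a b I \<tau> g f G F \<epsilon> \<theta>"
    proof
      show "(- d0 j + \<epsilon>) * \<theta> j + G j * (\<Sum>i\<in>UNIV. \<theta> i * A i j)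
          + F j * (\<Sum>i\<in>UNIV. \<theta> i * B i j * exp (\<epsilon> * \<tau> i j)) \<le> 0" for j
        using that(3)[of j] sum.remove[of UNIV j "\<lambda>i. \<theta> i * A i j"] by simp
    qed (use that in auto)
    then show ?thesis
      by (rule dominated_delay_system.unique_periodic_solution_exists)
  qed
  have part2: "\<exists>\<epsilon>>0. \<forall>i. ?lhs \<theta> \<epsilon> i \<le> 0"
    if "\<And>i. - d0 i * \<theta> i
      + G i * (\<theta> i * period_sup \<omega> (a i i) + (\<Sum>j\<in>UNIV - {i}. \<theta> j * period_sup \<omega> (a j i)))
      + F i * (\<Sum>j\<in>UNIV. \<theta> j * period_sup \<omega> (b j i)) < 0" for \<theta>
    using that by (rule strict_dominance_imp_rate)
  show ?thesis
  proof (intro conjI allI impI)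
    fix \<theta> assume \<theta>: "(\<forall>i. \<theta> i > 0) \<and>
        (\<forall>i. - d0 i * \<theta> i
           + G i * (\<theta> i * period_sup \<omega> (a i i) + (\<Sum>j\<in>UNIV - {i}. \<theta> j * period_sup \<omega> (a j i)))
           + F i * (\<Sum>j\<in>UNIV. \<theta> j * period_sup \<omega> (b j i)) < 0)"
    then obtain \<epsilon> where "\<epsilon> > 0" "\<And>i. ?lhs \<theta> \<epsilon> i \<le> 0"
      using part2[of \<theta>] by blast
    with \<theta> part1[of \<epsilon> \<theta>] show "\<exists>v. unique_periodic_delay_solution \<omega> d a b I \<tau> g f v \<and>
             (\<exists>\<epsilon>>0. \<forall>u. delay_solution d a b I \<tau> g f u \<longrightarrow>
               (\<forall>i. \<forall>t\<ge>- max_delay \<tau>.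
                 (\<lambda>j. \<bar>u (t + real j * \<omega>) $ i - v t $ i\<bar>) \<in> O(\<lambda>j. exp (- (real j * \<epsilon> * \<omega>)))))"
      by blast
  qed (use part1 in blast)
qed

end
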